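(* Let $\alpha<1$ and $\Delta>0$ be real numbers, and let $$K(\alpha,\Delta):=\begin{cases}\dfrac{1-\alpha}{2\Delta} & (\alpha<0),\\[2mm] \left(\Psi\left(\dfrac{1}{2\Delta}+\dfrac12\right)-\Psi\left(\dfrac{1}{2\Delta}\right)\right)^{-1} & (\alpha=0),\\[3mm] \dfrac{1-\alpha}{\Delta} & (0<\alpha<1),\end{cases}$$ where $\Psi(z)=\Gamma'(z)/\Gamma(z)$ is the digamma function. Let $\{X_n\}_{n\ge 0}$ be the linearly edge-reinforced random walk on $\mathbb{Z}_+$ started at $0$ with initial weights $f(0,0)=1$, $f(0,x)=x^{\alpha}$ for $x\in\{1,2,\dots\}$, and reinforcement parameter $\Delta$. Then $$\limsup_{n\to\infty}\frac{X_n}{\{K(\alpha,\Delta)\log n\}^{1/(1-\alpha)}}=1\quad\text{almost surely.}$$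
   Context: $\mathbb{Z}_+=\{0,1,2,\dots\}$. The linearly edge-reinforced random walk (LERRW) on $\mathbb{Z}_+$ with initial weights $f(0,x)>0$ ($x\in\mathbb{Z}_+$) and reinforcement parameter $\Delta\ge 0$ is the nearest-neighbour process $\{X_n\}_{n\ge0}$ on $\mathbb{Z}_+$ with $P(X_0=0)=1$ defined as follows. For $x\in\mathbb{Z}_+$ let $\phi_n(x)=\sum_{i=1}^n 1_{\{\{X_{i-1},X_i\}=\{x,x+1\}\}}$ be the number of traversals of the edge $\{x,x+1\}$ by time $n$, and let the weight of the edge $\{x,x+1\}$ at time $n$ be $w_n(x)=f(0,x)+\Delta\,\phi_n(x)$; set $w_n(-1)=0$ for all $n$. The transition probabilities are $$P(X_{n+1}=X_n+1\mid X_0,\dots,X_n)=1-P(X_{n+1}=X_n-1\mid X_0,\dots,X_n)=\frac{w_n(X_n)}{w_n(X_n-1)+w_n(X_n)}.$$ *)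

theory Defs
  imports "HOL-Probability.Probability"
begin

definition traversals :: "(nat \<Rightarrow> nat) \<Rightarrow> nat \<Rightarrow> nat \<Rightarrow> nat" where
  "traversals p n x = (\<Sum>i=1..n. of_bool ({p (i - 1), p i} = {x, x + 1}))"

definition edge_weight :: "(nat \<Rightarrow> real) \<Rightarrow> real \<Rightarrow> (nat \<Rightarrow> nat) \<Rightarrow> nat \<Rightarrow> nat \<Rightarrow> real" where
  "edge_weight f \<Delta> p n x = f x + \<Delta> * real (traversals p n x)"

text \<open>The weight of the edge to the left of \<open>x\<close>; the first equation is the
  convention \<open>w\<^sub>n(-1) = 0\<close>.\<close>

fun left_weight :: "(nat \<Rightarrow> real) \<Rightarrow> real \<Rightarrow> (nat \<Rightarrow> nat) \<Rightarrow> nat \<Rightarrow> nat \<Rightarrow> real" where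
  "left_weight f \<Delta> p n 0 = 0"
| "left_weight f \<Delta> p n (Suc x) = edge_weight f \<Delta> p n x"

definition up_prob :: "(nat \<Rightarrow> real) \<Rightarrow> real \<Rightarrow> (nat \<Rightarrow> nat) \<Rightarrow> nat \<Rightarrow> real" where
  "up_prob f \<Delta> p n =
     edge_weight f \<Delta> p n (p n) / (left_weight f \<Delta> p n (p n) + edge_weight f \<Delta> p n (p n))"

text \<open>The state space is countable, so conditioning on \<open>X\<^sub>0, \<dots>, X\<^sub>n\<close> is elementary
  conditioning on the histories \<open>X\<^sub>0 = p 0, \<dots>, X\<^sub>n = p n\<close> of positive probability
  (only the values \<open>p 0, \<dots>, p n\<close> matter). A down step is written
  \<open>X\<^sub>n\<^sub>+\<^sub>1 + 1 = X\<^sub>n\<close> because subtraction on \<open>nat\<close> truncates at \<open>0\<close>.\<close>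

locale lerrw = prob_space M
  for M :: "'a measure" and f :: "nat \<Rightarrow> real" and \<Delta> :: real and X :: "nat \<Rightarrow> 'a \<Rightarrow> nat" +
  assumes weights_pos: "\<And>x. f x > 0"
    and reinforcement_nonneg: "\<Delta> \<ge> 0"
    and measurable_X: "\<And>n. X n \<in> measurable M (count_space UNIV)"
    and start: "\<P>(\<omega> in M. X 0 \<omega> = 0) = 1"
    and step_up: "\<And>n p. \<P>(\<omega> in M. \<forall>i\<le>n. X i \<omega> = p i) > 0 \<Longrightarrow>
      \<P>(\<omega> in M. X (n + 1) \<omega> = X n \<omega> + 1 \<bar> \<forall>i\<le>n. X i \<omega> = p i) = up_prob f \<Delta> p n"
    and step_down: "\<And>n p. \<P>(\<omega> in M. \<forall>i\<le>n. X i \<omega> = p i) > 0 \<Longrightarrow>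
      \<P>(\<omega> in M. X (n + 1) \<omega> + 1 = X n \<omega> \<bar> \<forall>i\<le>n. X i \<omega> = p i) = 1 - up_prob f \<Delta> p n"

text \<open>Only meant for \<open>\<alpha> < 1\<close> and \<open>\<Delta> > 0\<close>.\<close>

definition K :: "real \<Rightarrow> real \<Rightarrow> real" where
  "K \<alpha> \<Delta> =
     (if \<alpha> < 0 then (1 - \<alpha>) / (2 * \<Delta>)
      else if \<alpha> = 0 then inverse (Digamma (1 / (2 * \<Delta>) + 1 / 2) - Digamma (1 / (2 * \<Delta>)))
      else (1 - \<alpha>) / \<Delta>)"

text \<open>The case split matters: \<open>0 powr \<alpha> = 0\<close> in HOL, even for \<open>\<alpha> = 0\<close>.\<close>

definition power_weights :: "real \<Rightarrow> nat \<Rightarrow> real" where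
  "power_weights \<alpha> x = (if x = 0 then 1 else real x powr \<alpha>)"

end

theory Submission
  imports Defs "HOL-Real_Asymp.Real_Asymp"
begin

text \<open>
  Divide all edge weights by \<open>2\<Delta>\<close>, and write \<open>b\<^sub>y\<close> for the scaled initial weight of
  \<open>{y, y + 1}\<close>. The two edges at a vertex \<open>y \<ge> 1\<close> then form a Polya urn: between two visits to \<open>y\<close>
  the walk leaves and returns through the same edge, which adds one full unit to that edge. The urn
  starts with \<open>b\<^sub>y\<^sub>-\<^sub>1 + 1/2\<close> on the left (the first visit comes from the left) and \<open>b\<^sub>y\<close> on the right.
  By de Finetti the walk is therefore a random walk in an environment of independent Beta variables,
  whose potential grows by \<open>\<Psi>(b\<^sub>y + 1/2) - \<Psi>(b\<^sub>y)\<close> per edge up to boundary terms. The potential of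
  level \<open>N\<close> is asymptotic to \<open>N powr (1 - \<alpha>) / K \<alpha> \<Delta>\<close>, and this should be the logarithm of the
  hitting time \<open>T\<^sub>N\<close> of \<open>N\<close>.

  The proof never constructs the environment. For urn contents \<open>l\<close> and \<open>r\<close> the quantity
  \<open>\<Gamma>(l + s) / \<Gamma>(l) \<sqdot> \<Gamma>(r - s) / \<Gamma>(r)\<close> is a martingale, namely the conditional expectation of the
  \<open>s\<close>-th power of the limiting odds of the urn, and so is its product over any finite set of vertices
  (\<open>urn_mart\<close>). Seen from the current position, the left content of \<open>y + 1\<close> and the right content of
  \<open>y\<close> are the weight of one and the same edge and differ by exactly \<open>1/2\<close>. Hence the products rearrange
  into one factor per edge, and log-convexity of \<open>\<Gamma>\<close> says on which side of \<open>1\<close> that factor lies.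

  For a small negative exponent \<open>-\<sigma>\<close> the product over \<open>{1..<N}\<close> is at least a constant times
  \<open>t powr -\<sigma>\<close> when \<open>N\<close> is reached by time \<open>t\<close>, since only the weight of the edge \<open>{0, 1}\<close>
  remains. With optional stopping this bounds the probability of \<open>T\<^sub>N \<le> t\<close> (\<open>prob_hit_early\<close>). For the
  exponent \<open>+\<sigma>\<close> the products over all blocks \<open>{i..<j}\<close>, summed over \<open>j\<close>, dominate the \<open>\<sigma>\<close>-th power of
  the local time of the edge \<open>{i - 1, i}\<close> as long as \<open>N\<close> has not been reached. By time \<open>t\<close> one of these
  local times is at least \<open>t / N\<close>, which bounds the probability of \<open>T\<^sub>N > t\<close> (\<open>prob_hit_late\<close>).

  With \<open>\<sigma>\<close> of order \<open>N powr min \<alpha> 0\<close>, so that \<open>\<sigma>\<close> stays small relative to all initial weights below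
  \<open>N\<close>, both bounds decay like a polynomial times \<open>exp (-c N powr \<gamma>)\<close> with \<open>\<gamma> > 0\<close> at the times
  \<open>exp ((1 \<mp> \<delta>) N powr (1 - \<alpha>) / K \<alpha> \<Delta>)\<close>. The Borel--Cantelli lemma shows that almost surely
  only finitely many levels are reached too early, which bounds the upper limit from above. For the
  other bound it is enough that the probability of being late tends to \<open>0\<close>: then almost surely
  infinitely many levels are reached in time.
\<close>

section \<open>Ratios of Gamma values\<close>

lemma powr_le_1_plus:
  assumes "x > (0::real)" "0 \<le> s" "s \<le> 1"
  shows "x powr s \<le> 1 + x"
proof (cases "x \<le> 1")
  case True
  hence "x powr s \<le> 1" using assms by (intro powr_le1) auto
  thus ?thesis using assms by simp
next
  case False
  hence "x powr s \<le> x powr 1" using assms by (intro powr_mono) auto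
  thus ?thesis using assms by simp
qed

text \<open>Split \<open>(x + y) powr s\<close> as \<open>x (x + y) powr (s - 1) + y (x + y) powr (s - 1)\<close>; the power with the
  negative exponent only grows when \<open>x + y\<close> is replaced by \<open>x\<close> or by \<open>y\<close>.\<close>

lemma powr_subadditive:
  fixes x y :: real
  assumes "x > 0" "y > 0" "0 \<le> s" "s \<le> 1"
  shows "(x + y) powr s \<le> x powr s + y powr s"
proof -
  have *: "u * (x + y) powr (s - 1) \<le> u powr s" if "0 < u" "u \<le> x + y" for u
  proof -
    have "u * (x + y) powr (s - 1) \<le> u * u powr (s - 1)"
      using that assms by (intro mult_left_mono powr_mono2') auto
    thus ?thesis using that by (simp add: powr_mult_base)
  qed
  have "(x + y) powr s = (x + y) * (x + y) powr (s - 1)" using assms by (simp add: powr_mult_base)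
  thus ?thesis using *[of x] *[of y] assms by (simp add: algebra_simps)
qed

text \<open>For large \<open>x\<close> this behaves like \<open>x powr s\<close>. Unlike the power it satisfies the exact one-step
  recursion \<open>Gamma_ratio_plus1\<close>, which is what makes the urn products martingales.\<close>

definition Gamma_ratio :: "real \<Rightarrow> real \<Rightarrow> real" where
  "Gamma_ratio s x = Gamma (x + s) / Gamma x"

lemma Gamma_plus1_real_pos:
  assumes "x > (0::real)"
  shows "Gamma (x + 1) = x * Gamma x"
  using assms by (intro Gamma_plus1) (auto elim!: nonpos_Ints_cases)

lemma Gamma_ratio_pos: "x > 0 \<Longrightarrow> x + s > 0 \<Longrightarrow> Gamma_ratio s x > 0"
  unfolding Gamma_ratio_def by (intro divide_pos_pos Gamma_real_pos)

lemma Gamma_ratio_plus1: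
  assumes "x > 0" "x + s > 0"
  shows "Gamma_ratio s (x + 1) = (x + s) / x * Gamma_ratio s x"
proof -
  have "Gamma (x + s + 1) = (x + s) * Gamma (x + s)" "Gamma (x + 1) = x * Gamma x"
    using assms by (auto intro!: Gamma_plus1_real_pos)
  thus ?thesis by (simp add: Gamma_ratio_def add_ac)
qed

lemma Gamma_ratio_shift:
  assumes "x > 0" "x > t"
  shows "Gamma_ratio (- t) x = 1 / Gamma_ratio t (x - t)"
  using assms by (simp add: Gamma_ratio_def)

text \<open>The tangent inequality of the convex function \<open>ln_Gamma\<close>. It gives both exponential bounds on
  \<open>Gamma_ratio\<close>, for exponents of either sign.\<close>

lemma ln_Gamma_tangent:
  assumes "x > 0" "z > (0::real)"
  shows "ln_Gamma z + Digamma z * (x - z) \<le> ln_Gamma x"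
proof -
  have "Digamma z * (x - z) \<le> ln_Gamma x - ln_Gamma z"
  proof (rule convex_on_imp_above_tangent)
    show "convex_on {0<..} (ln_Gamma :: real \<Rightarrow> real)"
      by (rule convex_on_realI[of _ _ Digamma])
         (auto intro!: derivative_eq_intros Polygamma_real_mono)
    show "(ln_Gamma has_real_derivative Digamma z) (at z within {0<..})"
      using assms by (auto intro!: derivative_eq_intros)
  qed (use assms in \<open>auto simp: interior_open\<close>)
  thus ?thesis by simp
qed

lemma Gamma_ratio_exp:
  assumes "x > 0" "x + s > 0"
  shows "Gamma_ratio s x = exp (ln_Gamma (x + s) - ln_Gamma x)"
  using assms by (simp add: Gamma_ratio_def exp_diff Gamma_real_pos_exp)

lemma Gamma_ratio_le_exp:
  assumes "x > 0" "x + s > 0"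
  shows "Gamma_ratio s x \<le> exp (s * Digamma (x + s))"
  using ln_Gamma_tangent[of x "x + s"] assms by (simp add: Gamma_ratio_exp algebra_simps)

lemma Gamma_ratio_ge_exp:
  assumes "x > 0" "x + s > 0"
  shows "Gamma_ratio s x \<ge> exp (s * Digamma x)"
  using ln_Gamma_tangent[of "x + s" x] assms by (simp add: Gamma_ratio_exp algebra_simps)

text \<open>Log-convexity between \<open>x\<close> and \<open>x + 1\<close>.\<close>

lemma Gamma_ratio_le_powr:
  assumes "x > 0" "0 \<le> s" "s \<le> 1"
  shows "Gamma_ratio s x \<le> x powr s"
proof -
  have "convex_on {0<..} (ln_Gamma :: real \<Rightarrow> real)"
      by (rule convex_on_realI[of _ _ Digamma])
         (auto intro!: derivative_eq_intros Polygamma_real_mono)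
  from convex_onD[OF this, of s x "x + 1"] assms
  have "ln_Gamma (x + s) \<le> (1 - s) * ln_Gamma x + s * ln_Gamma (x + 1)"
    by (simp add: algebra_simps)
  also have "ln_Gamma (x + 1) = ln x + ln_Gamma x"
    using assms Gamma_real_pos[of x]
    by (simp add: less_imp_neq[symmetric] ln_Gamma_real_pos Gamma_plus1_real_pos ln_mult)
  finally show ?thesis using assms
    by (simp add: Gamma_ratio_exp powr_def algebra_simps)
qed

lemma Gamma_ratio_ge_powr:
  assumes "x > 0" "0 \<le> s" "s \<le> 1"
  shows "Gamma_ratio s x \<ge> x / (x + s) * (x + s) powr s"
proof -
  have "x * Gamma x = Gamma (x + 1)" using assms by (simp add: Gamma_plus1_real_pos)
  also have "\<dots> = Gamma_ratio (1 - s) (x + s) * Gamma (x + s)"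
    using assms Gamma_real_pos[of "x + s"] by (simp add: Gamma_ratio_def less_imp_neq[symmetric])
  also have "\<dots> \<le> (x + s) powr (1 - s) * Gamma (x + s)"
    using assms by (intro mult_right_mono Gamma_ratio_le_powr) (auto simp: less_imp_le Gamma_real_pos)
  finally have *: "x * Gamma x \<le> (x + s) powr (1 - s) * Gamma (x + s)" .
  have e: "(x + s) powr (1 - s) = (x + s) / (x + s) powr s"
    using assms by (simp add: powr_diff)
  have P: "Gamma x > 0" "(x + s) powr s > 0" "x + s > 0" using assms by auto
  show ?thesis using * P unfolding e Gamma_ratio_def by (simp add: field_simps)
qed

lemma Gamma_ratio_neg_ge_powr:
  assumes "x > s" "0 \<le> s" "s \<le> 1"
  shows "Gamma_ratio (- s) x \<ge> x powr (- s)"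
proof -
  have "Gamma_ratio s (x - s) \<le> (x - s) powr s"
    using assms by (intro Gamma_ratio_le_powr) auto
  also have "\<dots> \<le> x powr s" using assms by (intro powr_mono2) auto
  finally have "1 / x powr s \<le> 1 / Gamma_ratio s (x - s)"
    using assms Gamma_ratio_pos[of "x - s" s] by (intro divide_left_mono) auto
  thus ?thesis using assms by (simp add: Gamma_ratio_shift powr_minus field_simps)
qed

lemma Gamma_ratio_ge_third:
  assumes "x \<ge> 1/2" "0 \<le> s" "s \<le> 1/4"
  shows "Gamma_ratio s x \<ge> 1/3"
proof -
  have "1/2 \<le> (1/2::real) powr s" using powr_mono'[of s 1 "1/2::real"] assms by simp
  also have "\<dots> \<le> (x + s) powr s" using assms by (intro powr_mono2) auto
  finally have 1: "1/2 \<le> (x + s) powr s" .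
  have 2: "2/3 \<le> x / (x + s)" using assms by (simp add: field_simps)
  have "1/3 \<le> x / (x + s) * (x + s) powr s" using mult_mono[OF 2 1] assms by simp
  thus ?thesis using Gamma_ratio_ge_powr[of x s] assms by linarith
qed

lemma Gamma_ratio_neg_le:
  assumes "x \<ge> 1/2" "0 \<le> s" "s \<le> 1/4"
  shows "Gamma_ratio (- s) x \<le> 4"
proof -
  have "1/2 \<le> (1/2::real) powr s" using powr_mono'[of s 1 "1/2::real"] assms by simp
  also have "\<dots> \<le> x powr s" using assms by (intro powr_mono2) auto
  finally have 1: "1/2 \<le> x powr s" .
  have 2: "1/2 \<le> (x - s) / x" using assms by (simp add: field_simps)
  have "1/4 \<le> (x - s) / x * x powr s" using mult_mono[OF 2 1] assms by simp
  also have "\<dots> \<le> Gamma_ratio s (x - s)" using Gamma_ratio_ge_powr[of "x - s" s] assms by simp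
  finally have "1/4 \<le> Gamma_ratio s (x - s)" .
  thus ?thesis using assms by (simp add: Gamma_ratio_shift field_simps)
qed

text \<open>For a small argument \<open>x\<close> one step of the recursion leads back to arguments above \<open>1\<close>; the
  factor \<open>x / (x - s)\<close> it costs is at most \<open>2\<close>.\<close>

lemma Gamma_ratio_neg_le_small:
  assumes "x > 0" "0 \<le> s" "s \<le> 1/4" "s \<le> x / 2"
  shows "Gamma_ratio (- s) x \<le> 8"
proof -
  have p: "x + - s > 0" using assms by auto
  have "(x - s) / x * Gamma_ratio (- s) x = Gamma_ratio (- s) (x + 1)"
    using Gamma_ratio_plus1[OF assms(1) p] by simp
  also have "\<dots> \<le> 4" using assms by (intro Gamma_ratio_neg_le) auto
  finally have a: "(x - s) / x * Gamma_ratio (- s) x \<le> 4" .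
  have "1/2 \<le> (x - s) / x" using assms by (simp add: field_simps)
  hence "1/2 * Gamma_ratio (- s) x \<le> (x - s) / x * Gamma_ratio (- s) x"
    using Gamma_ratio_pos[OF assms(1) p] by (intro mult_right_mono) auto
  with a show ?thesis by linarith
qed

text \<open>The factor contributed by a single edge: \<open>v\<close> is the content seen from one endpoint and
  \<open>v + 1/2\<close> the content seen from the other one. The product exceeds \<open>1\<close> because \<open>ln_Gamma\<close> is steeper
  to the right.\<close>

lemma Gamma_ratio_pair_ge1:
  assumes "0 \<le> s" "s < v"
  shows "Gamma_ratio s (v + 1/2) * Gamma_ratio (- s) v \<ge> 1"
proof -
  have "exp (s * Digamma (v + 1/2)) * exp (- s * Digamma v) \<le>
        Gamma_ratio s (v + 1/2) * Gamma_ratio (- s) v"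
    using assms by (intro mult_mono Gamma_ratio_ge_exp less_imp_le[OF Gamma_ratio_pos]) auto
  moreover have "s * Digamma v \<le> s * Digamma (v + 1/2)"
    using assms by (intro mult_left_mono Digamma_real_mono) auto
  ultimately show ?thesis by (simp flip: exp_add) (smt (verit) one_le_exp_iff)
qed

text \<open>The factor of an edge with its initial weight, in a product with a negative exponent. Tangents at
  the shifted arguments produce the Digamma difference, the potential of the edge.\<close>

lemma Gamma_ratio_pair_le_down:
  assumes "0 \<le> s" "s < b" "s \<le> 1/4"
  shows "Gamma_ratio s b * Gamma_ratio (- s) (b + 1/2)
           \<le> exp (- s * (Digamma (b + 1/2 - s) - Digamma (b + s)))"
proof -
  have "Gamma_ratio s b * Gamma_ratio (- s) (b + 1/2)
     \<le> exp (s * Digamma (b + s)) * exp (- s * Digamma (b + 1/2 + - s))"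
    using assms by (intro mult_mono Gamma_ratio_le_exp less_imp_le[OF Gamma_ratio_pos]) auto
  thus ?thesis by (simp add: algebra_simps flip: exp_add)
qed

text \<open>The counterpart for a positive exponent, where the factor exceeds \<open>1\<close>.\<close>

lemma Gamma_ratio_pair_le_up:
  assumes "0 \<le> s" "s < b"
  shows "Gamma_ratio (- s) b * Gamma_ratio s (b + 1/2)
           \<le> exp (s * (Digamma (b + 1/2 + s) - Digamma (b - s)))"
proof -
  have "Gamma_ratio (- s) b * Gamma_ratio s (b + 1/2)
     \<le> exp (- s * Digamma (b + - s)) * exp (s * Digamma (b + 1/2 + s))"
    using assms by (intro mult_mono Gamma_ratio_le_exp less_imp_le[OF Gamma_ratio_pos]) auto
  thus ?thesis by (simp add: algebra_simps flip: exp_add)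
qed

text \<open>Both sides are close to \<open>l powr s\<close>, and raising \<open>l\<close> by at most \<open>1/2\<close> changes that power by a
  bounded amount because \<open>s\<close> is small. The slack \<open>2\<close> absorbs this. It has to be additive: a constant
  factor per vertex would change the exponential growth rate when \<open>\<alpha> = 0\<close>.\<close>

lemma Gamma_ratio_compensate:
  assumes "l \<ge> 1/2" "0 \<le> s" "s \<le> 1/4" "s < r" "r \<le> l + 1/2"
  shows "1 / Gamma_ratio (- s) r \<le> 2 + Gamma_ratio s l"
proof -
  have "1 / Gamma_ratio (- s) r = Gamma_ratio s (r - s)" using assms by (simp add: Gamma_ratio_shift)
  also have "\<dots> \<le> (r - s) powr s" using assms by (intro Gamma_ratio_le_powr) auto
  also have "\<dots> \<le> (l + s + 1/2) powr s" using assms by (intro powr_mono2) auto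
  also have "\<dots> \<le> (l + s) powr s + (1/2) powr s"
    using assms by (intro powr_subadditive) auto
  also have "(1/2) powr s \<le> (1::real)" using assms by (intro powr_le1) auto
  finally have 1: "1 / Gamma_ratio (- s) r \<le> (l + s) powr s + 1" by simp
  have "(l + s) powr s - s / (l + s) * (l + s) powr s = l / (l + s) * (l + s) powr s"
    using assms by (simp add: field_simps)
  also have "\<dots> \<le> Gamma_ratio s l" using assms by (intro Gamma_ratio_ge_powr) auto
  finally have 2: "(l + s) powr s - s / (l + s) * (l + s) powr s \<le> Gamma_ratio s l" .
  have "s / (l + s) * (l + s) powr s = s * (l + s) powr (s - 1)"
    using assms by (simp add: powr_diff)
  also have "\<dots> \<le> s * (1/2) powr (s - 1)" using assms by (intro mult_left_mono powr_mono2') auto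
  also have "\<dots> \<le> s * (1/2) powr (- 1)" using assms by (intro mult_left_mono powr_mono') auto
  also have "\<dots> \<le> 1" using assms by (simp add: powr_minus)
  finally show ?thesis using 1 2 by linarith
qed

section \<open>Nearest-neighbour paths\<close>

text \<open>The possible histories up to time \<open>n\<close>, continued by \<open>0\<close> so that each history is represented by one
  function.\<close>

fun paths :: "nat \<Rightarrow> (nat \<Rightarrow> nat) set" where
  "paths 0 = {\<lambda>_. 0}"
| "paths (Suc n) = (\<lambda>p. p(Suc n := p n + 1)) ` paths n
                 \<union> (\<lambda>p. p(Suc n := p n - 1)) ` {p \<in> paths n. p n > 0}"

lemma finite_paths [simp]: "finite (paths n)"
  by (induction n) auto

lemma paths_beyond: "p \<in> paths n \<Longrightarrow> i > n \<Longrightarrow> p i = 0"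
  by (induction n arbitrary: p) auto

lemma paths_inj: "inj_on (\<lambda>p. p(Suc n := f p)) (paths n)"
proof (rule inj_onI)
  fix p q assume pq: "p \<in> paths n" "q \<in> paths n" "p(Suc n := f p) = q(Suc n := f q)"
  hence "p(Suc n := 0) = q(Suc n := 0)" by (metis fun_upd_upd)
  moreover have "p(Suc n := 0) = p" "q(Suc n := 0) = q"
    using pq paths_beyond by fastforce+
  ultimately show "p = q" by simp
qed

lemma paths_start: "p \<in> paths n \<Longrightarrow> p 0 = 0"
  by (induction n arbitrary: p) auto

lemma paths_step:
  "p \<in> paths n \<Longrightarrow> i < n \<Longrightarrow> p (Suc i) = p i + 1 \<or> p (Suc i) + 1 = p i"
proof (induction n arbitrary: p)
  case (Suc n)
  then obtain q where q: "q \<in> paths n" "p = q(Suc n := q n + 1) \<or> q n > 0 \<and> p = q(Suc n := q n - 1)"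
    by auto
  show ?case
  proof (cases "i < n")
    case True
    have "p i = q i" "p (Suc i) = q (Suc i)" using q(2) True by auto
    with Suc.IH[OF q(1) True] show ?thesis by simp
  next
    case False
    with Suc.prems have "i = n" by simp
    with q(2) show ?thesis by auto
  qed
qed simp

lemma paths_le: "p \<in> paths n \<Longrightarrow> i \<le> n \<Longrightarrow> p i \<le> i"
proof (induction i)
  case (Suc i)
  thus ?case using paths_step[of p n i] by auto
qed (simp add: paths_start)

lemma paths_eqI: "p \<in> paths n \<Longrightarrow> q \<in> paths n \<Longrightarrow> (\<And>i. i \<le> n \<Longrightarrow> p i = q i) \<Longrightarrow> p = q"
  by (rule ext) (metis paths_beyond not_le_imp_less)

lemma sum_paths_Suc:
  fixes F :: "(nat \<Rightarrow> nat) \<Rightarrow> real"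
  shows "(\<Sum>p\<in>paths (Suc n). F p) =
    (\<Sum>p\<in>paths n. F (p(Suc n := p n + 1)) + (if p n > 0 then F (p(Suc n := p n - 1)) else 0))"
proof -
  let ?A = "(\<lambda>p. p(Suc n := p n + 1)) ` paths n"
  let ?B = "(\<lambda>p. p(Suc n := p n - 1)) ` {p \<in> paths n. p n > 0}"
  have disj: "?A \<inter> ?B = {}"
  proof -
    have "False" if "p \<in> paths n" "q \<in> paths n" "q n > 0"
      "p(Suc n := p n + 1) = q(Suc n := q n - 1)" for p q
    proof -
      from that(4) have "p n = q n" "p n + 1 = q n - 1"
        by (metis fun_upd_other n_not_Suc_n, metis fun_upd_same)
      thus False by simp
    qed
    thus ?thesis by blast
  qed
  have "(\<Sum>p\<in>paths (Suc n). F p) = sum F ?A + sum F ?B"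
    using disj by (simp add: sum.union_disjoint)
  also have "sum F ?A = (\<Sum>p\<in>paths n. F (p(Suc n := p n + 1)))"
    by (subst sum.reindex) (auto intro: paths_inj)
  also have "sum F ?B = (\<Sum>p\<in>{p\<in>paths n. p n > 0}. F (p(Suc n := p n - 1)))"
    by (subst sum.reindex) (auto intro: inj_on_subset[OF paths_inj])
  also have "\<dots> = (\<Sum>p\<in>paths n. if p n > 0 then F (p(Suc n := p n - 1)) else 0)"
    by (subst sum.inter_filter) simp_all
  finally show ?thesis by (simp only: sum.distrib)
qed

lemma traversals_Suc:
  "traversals (p(Suc n := a)) (Suc n) y = traversals p n y + of_bool ({p n, a} = {y, y + 1})"
proof -
  have "(\<Sum>i=1..n. of_bool ({(p(Suc n := a)) (i - 1), (p(Suc n := a)) i} = {y, y + 1})) =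
        (\<Sum>i=1..n. of_bool ({p (i - 1), p i} = {y, y + 1}) :: nat)"
  proof (rule sum.cong[OF refl])
    fix i assume "i \<in> {1..n}"
    hence "(p(Suc n := a)) (i - 1) = p (i - 1)" "(p(Suc n := a)) i = p i" by auto
    thus "of_bool ({(p(Suc n := a)) (i - 1), (p(Suc n := a)) i} = {y, y + 1}) =
          (of_bool ({p (i - 1), p i} = {y, y + 1}) :: nat)" by (simp only:)
  qed
  moreover have "(p(Suc n := a)) (Suc n - 1) = p n" "(p(Suc n := a)) (Suc n) = a" by auto
  ultimately show ?thesis
    unfolding traversals_def by (subst sum.nat_ivl_Suc') (simp_all only: add.commute)
qed

lemma traversals_0 [simp]: "traversals p 0 y = 0"
  by (simp add: traversals_def)

lemma paths_Suc_cases: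
  assumes "p \<in> paths (Suc n)"
  obtains q where "q \<in> paths n" "p = q(Suc n := q n + 1)"
        | q where "q \<in> paths n" "q n > 0" "p = q(Suc n := q n - 1)"
  using assms by auto

lemma traversals_ge_1:
  assumes "p \<in> paths n" "y < p n"
  shows "traversals p n y \<ge> 1"
  using assms
proof (induction n arbitrary: p)
  case (Suc n)
  from Suc.prems(1) show ?case
  proof (cases rule: paths_Suc_cases)
    case (1 q)
    show ?thesis
    proof (cases "y < q n")
      case True
      thus ?thesis using Suc.IH[OF 1(1)] unfolding 1(2) traversals_Suc by simp
    next
      case False
      with Suc.prems(2) 1(2) have "y = q n" by simp
      thus ?thesis unfolding 1(2) traversals_Suc by simp
    qed
  next
    case (2 q)
    thus ?thesis using Suc.IH[OF 2(1)] Suc.prems(2) unfolding 2(3) traversals_Suc by simp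
  qed
qed auto

lemma traversals_eq_0:
  assumes "\<And>k. k \<le> n \<Longrightarrow> p k \<noteq> y + 1"
  shows "traversals p n y = 0"
  unfolding traversals_def
proof (intro sum.neutral ballI)
  fix i assume i: "i \<in> {1..n}"
  hence "p (i - 1) \<noteq> y + 1" "p i \<noteq> y + 1" using assms by auto
  hence "{p (i - 1), p i} \<noteq> {y, y + 1}" unfolding doubleton_eq_iff by blast
  thus "of_bool ({p (i - 1), p i} = {y, y + 1}) = (0::nat)" by simp
qed

lemma traversals_le: "traversals p n y \<le> n"
proof -
  have "traversals p n y \<le> (\<Sum>i=1..n. 1)"
    unfolding traversals_def by (intro sum_mono) auto
  thus ?thesis by simp
qed

text \<open>Each step crosses exactly one edge, namely the one below the larger of its two endpoints.\<close>

lemma sum_traversals: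
  assumes "p \<in> paths n" "\<And>k. k \<le> n \<Longrightarrow> p k < N"
  shows "(\<Sum>y\<in>{1..<N}. traversals p n (y - 1)) = n"
proof -
  have single: "(\<Sum>y\<in>{1..<N}. of_bool ({a, c} = {y - 1, y - 1 + 1})) = (1::nat)"
    if "c = a + 1 \<or> c + 1 = a" "a < N" "c < N" for a c :: nat
  proof -
    have "of_bool ({a, c} = {y - 1, y - 1 + 1}) = (if y = max a c then 1 else (0::nat))" if "y \<in> {1..<N}" for y
    proof -
      have y: "y - 1 + 1 = y" using that by simp
      have "{a, c} = {y - 1, y} \<longleftrightarrow> y = max a c"
        using that \<open>c = a + 1 \<or> c + 1 = a\<close> unfolding doubleton_eq_iff by (elim disjE) (auto simp: max_def)
      thus ?thesis unfolding y by simp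
    qed
    hence "(\<Sum>y\<in>{1..<N}. of_bool ({a, c} = {y - 1, y - 1 + 1})) = (\<Sum>y\<in>{1..<N}. if y = max a c then 1 else (0::nat))"
      by (intro sum.cong refl)
    also have "\<dots> = 1" using that by auto
    finally show ?thesis .
  qed
  have "(\<Sum>y\<in>{1..<N}. traversals p n (y - 1)) =
        (\<Sum>i=1..n. \<Sum>y\<in>{1..<N}. of_bool ({p (i - 1), p i} = {y - 1, y - 1 + 1}))"
    unfolding traversals_def by (rule sum.swap)
  also have "\<dots> = (\<Sum>i=1..n. 1)"
  proof (intro sum.cong refl single)
    fix i assume i: "i \<in> {1..n}"
    hence "i - 1 < n" "Suc (i - 1) = i" by auto
    with paths_step[OF assms(1), of "i - 1"] show "p i = p (i - 1) + 1 \<or> p i + 1 = p (i - 1)"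
      by simp
  qed (use assms(2) in auto)
  finally show ?thesis by simp
qed

lemma paths_truncate:
  assumes "p \<in> paths n" "k \<le> n"
  shows "(\<lambda>i. if i \<le> k then p i else 0) \<in> paths k"
  using assms
proof (induction n arbitrary: p)
  case 0
  thus ?case by auto
next
  case (Suc n)
  show ?case
  proof (cases "k = Suc n")
    case True
    have "(\<lambda>i. if i \<le> k then p i else 0) = p"
      using paths_beyond[OF Suc.prems(1)] True by (intro ext) auto
    thus ?thesis using Suc.prems(1) True by simp
  next
    case False
    hence k: "k \<le> n" using Suc.prems by simp
    obtain q a where q: "q \<in> paths n" "p = q(Suc n := a)"
      using Suc.prems(1) by (elim paths_Suc_cases) blast+
    have "(\<lambda>i. if i \<le> k then p i else 0) = (\<lambda>i. if i \<le> k then q i else 0)"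
      using q(2) k by (intro ext) auto
    thus ?thesis using Suc.IH[OF q(1) k] by simp
  qed
qed

lemma paths_less:
  assumes "p \<in> paths n" "\<And>k. k \<le> n \<Longrightarrow> p k \<noteq> N" "N > 0" "k \<le> n"
  shows "p k < N"
  using assms(4)
proof (induction k)
  case 0
  thus ?case using paths_start[OF assms(1)] assms(3) by simp
next
  case (Suc k)
  thus ?case using paths_step[OF assms(1), of k] assms(2)[of "Suc k"] by auto
qed

text \<open>The first time at which the path is at \<open>N\<close>, capped at \<open>n\<close>.\<close>

fun stop_time :: "nat \<Rightarrow> nat \<Rightarrow> (nat \<Rightarrow> nat) \<Rightarrow> nat" where
  "stop_time N 0 p = 0"
| "stop_time N (Suc n) p = (if p (stop_time N n p) = N then stop_time N n p else Suc n)"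

lemma stop_time_le: "stop_time N n p \<le> n"
  by (induction n) auto

lemma stop_time_cong:
  "(\<And>i. i \<le> n \<Longrightarrow> p i = q i) \<Longrightarrow> stop_time N n p = stop_time N n q"
proof (induction n)
  case (Suc n)
  hence "stop_time N n p = stop_time N n q" by simp
  moreover have "p (stop_time N n q) = q (stop_time N n q)"
    using Suc.prems stop_time_le[of N n q] by simp
  ultimately show ?case by simp
qed simp

lemma stop_time_not_hit: "p (stop_time N n p) \<noteq> N \<Longrightarrow> stop_time N n p = n"
  by (induction n) (auto split: if_splits)

lemma stop_time_hit: "k \<le> n \<Longrightarrow> p k = N \<Longrightarrow> p (stop_time N n p) = N"
proof (induction n)
  case (Suc n)
  thus ?case by (cases "k = Suc n") auto
qed simp

text \<open>Regroups a product over vertices, with factors for the left and the right edge, into a product over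
  edges and two boundary factors.\<close>

lemma prod_shift:
  fixes A B :: "nat \<Rightarrow> 'base_weight :: comm_monoid_mult"
  assumes "i < j" "i \<ge> 1"
  shows "(\<Prod>y\<in>{i..<j}. A (y - 1) * B y) = A (i - 1) * (\<Prod>y\<in>{i..<j - 1}. B y * A y) * B (j - 1)"
  using assms
proof (induction j)
  case (Suc j)
  show ?case
  proof (cases "i = j")
    case False
    hence "i < j" using Suc.prems by simp
    hence j: "j = Suc (j - 1)" "i \<le> j - 1" by auto
    have "(\<Prod>y\<in>{i..<Suc j}. A (y - 1) * B y) = A (i - 1) * (\<Prod>y\<in>{i..<j - 1}. B y * A y) * B (j - 1) * (A (j - 1) * B j)"
      using Suc \<open>i < j\<close> by simp
    also have "\<dots> = A (i - 1) * ((\<Prod>y\<in>{i..<j - 1}. B y * A y) * (B (j - 1) * A (j - 1))) * B j"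
      by (simp only: mult_ac)
    also have "(\<Prod>y\<in>{i..<j - 1}. B y * A y) * (B (j - 1) * A (j - 1)) = (\<Prod>y\<in>{i..<Suc (j - 1)}. B y * A y)"
      using j(2) by simp
    finally show ?thesis using j(1) by simp
  qed simp
qed simp

section \<open>Expectations as finite sums over paths\<close>

context lerrw
begin

definition cyl :: "nat \<Rightarrow> (nat \<Rightarrow> nat) \<Rightarrow> 'a set" where
  "cyl n p = {\<omega> \<in> space M. \<forall>i\<le>n. X i \<omega> = p i}"

text \<open>Expectation of a function of the history, as a finite sum because there are only finitely many
  histories of a given length.\<close>

definition expect :: "nat \<Rightarrow> ((nat \<Rightarrow> nat) \<Rightarrow> real) \<Rightarrow> real" where
  "expect n F = (\<Sum>p\<in>paths n. prob (cyl n p) * F p)"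

lemma X_measurable [measurable]: "X n \<in> measurable M (count_space UNIV)"
  by (rule measurable_X)

lemma cyl_sets [measurable]: "cyl n p \<in> sets M"
  unfolding cyl_def by measurable

lemma traversals_cong: "(\<And>i. i \<le> n \<Longrightarrow> p i = q i) \<Longrightarrow> traversals p n x = traversals q n x"
  unfolding traversals_def by (intro sum.cong) auto

lemma edge_weight_pos: "edge_weight f \<Delta> p n x > 0"
  unfolding edge_weight_def using weights_pos[of x] reinforcement_nonneg
  by (intro add_pos_nonneg) auto

lemma up_prob_0: "p n = 0 \<Longrightarrow> up_prob f \<Delta> p n = 1"
  using edge_weight_pos[of p n 0] by (simp add: up_prob_def)

text \<open>Multiplication by the conditional probability; histories of probability \<open>0\<close> have extensions of
  probability \<open>0\<close>.\<close>

lemma prob_cyl_up: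
  "prob (cyl (Suc n) (p(Suc n := p n + 1))) = prob (cyl n p) * up_prob f \<Delta> p n"
proof (cases "prob (cyl n p) > 0")
  case True
  have "cyl (Suc n) (p(Suc n := p n + 1)) =
        {\<omega>\<in>space M. X (n + 1) \<omega> = X n \<omega> + 1 \<and> (\<forall>i\<le>n. X i \<omega> = p i)}"
    by (auto simp: cyl_def le_Suc_eq)
  moreover have "cond_prob M (\<lambda>\<omega>. X (n + 1) \<omega> = X n \<omega> + 1) (\<lambda>\<omega>. \<forall>i\<le>n. X i \<omega> = p i) = up_prob f \<Delta> p n"
    using True by (intro step_up) (simp add: cyl_def)
  ultimately show ?thesis using True by (simp add: cond_prob_def cyl_def field_simps)
next
  case False
  have "prob (cyl (Suc n) (p(Suc n := p n + 1))) \<le> prob (cyl n p)"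
    by (intro finite_measure_mono) (auto simp: cyl_def)
  thus ?thesis using False measure_nonneg[of M "cyl n p"] measure_nonneg[of M "cyl (Suc n) (p(Suc n := p n + 1))"]
    by (simp del: measure_nonneg)
qed

lemma prob_cyl_down:
  assumes "p n > 0"
  shows "prob (cyl (Suc n) (p(Suc n := p n - 1))) = prob (cyl n p) * (1 - up_prob f \<Delta> p n)"
proof (cases "prob (cyl n p) > 0")
  case True
  have "cyl (Suc n) (p(Suc n := p n - 1)) =
        {\<omega>\<in>space M. X (n + 1) \<omega> + 1 = X n \<omega> \<and> (\<forall>i\<le>n. X i \<omega> = p i)}"
    using assms by (auto simp: cyl_def le_Suc_eq)
  moreover have "cond_prob M (\<lambda>\<omega>. X (n + 1) \<omega> + 1 = X n \<omega>) (\<lambda>\<omega>. \<forall>i\<le>n. X i \<omega> = p i) = 1 - up_prob f \<Delta> p n"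
    using True by (intro step_down) (simp add: cyl_def)
  ultimately show ?thesis using True by (simp add: cond_prob_def cyl_def field_simps)
next
  case False
  have "prob (cyl (Suc n) (p(Suc n := p n - 1))) \<le> prob (cyl n p)"
    by (intro finite_measure_mono) (auto simp: cyl_def)
  thus ?thesis using False measure_nonneg[of M "cyl n p"] measure_nonneg[of M "cyl (Suc n) (p(Suc n := p n - 1))"]
    by (simp del: measure_nonneg)
qed

lemma expect_0: "expect 0 F = F (\<lambda>_. 0)"
  using start by (simp add: expect_def cyl_def)

lemma expect_Suc:
  "expect (Suc n) F = expect n (\<lambda>p. up_prob f \<Delta> p n * F (p(Suc n := p n + 1))
     + (1 - up_prob f \<Delta> p n) * F (p(Suc n := p n - 1)))"
  unfolding expect_def sum_paths_Suc
proof (intro sum.cong refl)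
  fix p assume "p \<in> paths n"
  show "prob (cyl (Suc n) (p(Suc n := p n + 1))) * F (p(Suc n := p n + 1)) +
         (if 0 < p n then prob (cyl (Suc n) (p(Suc n := p n - 1))) * F (p(Suc n := p n - 1)) else 0)
       = prob (cyl n p) * (up_prob f \<Delta> p n * F (p(Suc n := p n + 1))
     + (1 - up_prob f \<Delta> p n) * F (p(Suc n := p n - 1)))"
    unfolding prob_cyl_up
    by (cases "p n > 0") (simp_all add: prob_cyl_down[simplified] up_prob_0 algebra_simps)
qed

lemma expect_cong: "(\<And>p. p \<in> paths n \<Longrightarrow> F p = G p) \<Longrightarrow> expect n F = expect n G"
  unfolding expect_def by (intro sum.cong) auto

lemma expect_const [simp]: "expect n (\<lambda>_. c) = c"
proof (induction n)
  case (Suc n)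
  thus ?case by (simp add: expect_Suc algebra_simps)
qed (simp add: expect_0)

lemma expect_sum: "expect n (\<lambda>p. \<Sum>i\<in>I. F i p) = (\<Sum>i\<in>I. expect n (F i))"
  unfolding expect_def by (simp add: sum_distrib_left) (rule sum.swap)

lemma expect_cmult: "expect n (\<lambda>p. c * F p) = c * expect n F"
  unfolding expect_def by (simp add: sum_distrib_left mult_ac)

lemma expect_martingale:
  assumes "\<And>n p. p \<in> paths n \<Longrightarrow> up_prob f \<Delta> p n * F (Suc n) (p(Suc n := p n + 1))
     + (1 - up_prob f \<Delta> p n) * F (Suc n) (p(Suc n := p n - 1)) = F n p"
  shows "expect n (F n) = F 0 (\<lambda>_. 0)"
proof (induction n)
  case (Suc n)
  have "expect (Suc n) (F (Suc n)) = expect n (F n)"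
    unfolding expect_Suc by (intro expect_cong assms)
  with Suc show ?case by simp
qed (simp add: expect_0)

lemma disjoint_cyl: "disjoint_family_on (cyl n) (paths n)"
  unfolding disjoint_family_on_def
proof (intro ballI impI)
  fix p q assume "p \<in> paths n" "q \<in> paths n" "p \<noteq> q"
  then obtain i where "i \<le> n" "p i \<noteq> q i" by (meson paths_eqI)
  thus "cyl n p \<inter> cyl n q = {}" by (auto simp: cyl_def)
qed

text \<open>The step probabilities add up to \<open>1\<close>, so the cylinders of the nearest-neighbour paths have total
  mass \<open>1\<close>.\<close>

lemma AE_path: "AE \<omega> in M. \<exists>p\<in>paths n. \<forall>i\<le>n. X i \<omega> = p i"
proof -
  have "prob (\<Union>p\<in>paths n. cyl n p) = (\<Sum>p\<in>paths n. prob (cyl n p))"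
    by (intro finite_measure_finite_Union disjoint_cyl) auto
  also have "\<dots> = expect n (\<lambda>_. 1)" by (simp only: expect_def mult_1_right)
  also have "\<dots> = 1" by (rule expect_const)
  finally have "prob (\<Union>p\<in>paths n. cyl n p) = 1" .
  hence "AE \<omega> in M. \<omega> \<in> (\<Union>p\<in>paths n. cyl n p)"
    by (subst (asm) prob_eq_1) auto
  thus ?thesis by eventually_elim (auto simp: cyl_def)
qed

lemma AE_X_le: "AE \<omega> in M. \<forall>n. X n \<omega> \<le> n"
proof -
  have "AE \<omega> in M. X n \<omega> \<le> n" for n
    using AE_path[of n] by eventually_elim (use paths_le in auto)
  thus ?thesis by (subst AE_all_countable) blast
qed

text \<open>Markov's inequality for functions of the history: up to a null set the event is covered by the
  cylinders of the paths in \<open>H\<close>.\<close>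

lemma markov_paths:
  assumes "\<And>p. p \<in> paths n \<Longrightarrow> F p \<ge> 0" "c > 0"
    and "\<And>p. p \<in> paths n \<Longrightarrow> H p \<Longrightarrow> F p \<ge> c"
    and "\<And>p q. (\<And>i. i \<le> n \<Longrightarrow> p i = q i) \<Longrightarrow> H p \<longleftrightarrow> H q"
    and [measurable]: "{\<omega>\<in>space M. H (\<lambda>i. X i \<omega>)} \<in> sets M"
  shows "prob {\<omega>\<in>space M. H (\<lambda>i. X i \<omega>)} \<le> expect n F / c"
proof -
  let ?P = "{p\<in>paths n. H p}"
  have "prob {\<omega>\<in>space M. H (\<lambda>i. X i \<omega>)} \<le> prob (\<Union>p\<in>?P. cyl n p)"
  proof (rule finite_measure_mono_AE)
    show "AE \<omega> in M. \<omega> \<in> {\<omega>\<in>space M. H (\<lambda>i. X i \<omega>)} \<longrightarrow> \<omega> \<in> (\<Union>p\<in>?P. cyl n p)"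
      using AE_path[of n]
    proof eventually_elim
      case (elim \<omega>)
      then obtain p where p: "p \<in> paths n" "\<forall>i\<le>n. X i \<omega> = p i" by blast
      thus ?case using assms(4)[of "\<lambda>i. X i \<omega>" p] by (auto simp: cyl_def)
    qed
  qed auto
  also have "\<dots> = (\<Sum>p\<in>?P. prob (cyl n p))"
    by (intro finite_measure_finite_Union disjoint_family_on_mono[OF _ disjoint_cyl]) auto
  also have "\<dots> \<le> (\<Sum>p\<in>?P. prob (cyl n p) * (F p / c))"
    using assms(2,3) by (intro sum_mono mult_le_cancel_left1[THEN iffD2]) (auto simp: field_simps)
  also have "\<dots> \<le> (\<Sum>p\<in>paths n. prob (cyl n p) * (F p / c))"
    using assms(1,2) by (intro sum_mono2) auto
  also have "\<dots> = expect n F / c" by (simp add: expect_def sum_divide_distrib)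
  finally show ?thesis .
qed

end

section \<open>The urn martingales\<close>

locale lerrw_pos = lerrw +
  assumes reinforcement_pos: "\<Delta> > 0"
begin

definition base_weight :: "nat \<Rightarrow> real" where "base_weight y = f y / (2 * \<Delta>)"

text \<open>The scaled weight that the left edge of \<open>y\<close> will have at the next visit to \<open>y\<close>. If the walk is below
  \<open>y\<close>, it has to enter \<open>y\<close> through this edge, which is crossed exactly once until then and so gains
  \<open>1/2\<close>. From above, the walk enters through the right edge, hence the mirrored definition of
  \<open>right_urn\<close>.\<close>

definition left_urn :: "(nat \<Rightarrow> nat) \<Rightarrow> nat \<Rightarrow> nat \<Rightarrow> real" where
  "left_urn p n y = base_weight (y - 1) + traversals p n (y - 1) / 2 + (if y \<le> p n then 0 else 1/2)"

definition right_urn :: "(nat \<Rightarrow> nat) \<Rightarrow> nat \<Rightarrow> nat \<Rightarrow> real" where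
  "right_urn p n y = base_weight y + traversals p n y / 2 + (if y < p n then 1/2 else 0)"

lemma base_weight_pos: "base_weight y > 0"
  using weights_pos[of y] reinforcement_pos by (simp add: base_weight_def)

lemma left_urn_ge: 
  assumes "p \<in> paths n" "y \<ge> 1"
  shows "left_urn p n y \<ge> base_weight (y - 1) + 1/2"
  using traversals_ge_1[OF assms(1), of "y - 1"] assms(2) by (auto simp: left_urn_def)

lemma left_urn_ge_half: 
  assumes "p \<in> paths n" "y \<ge> 1"
  shows "left_urn p n y \<ge> 1/2"
  using left_urn_ge[OF assms] base_weight_pos[of "y - 1"] by linarith

lemma right_urn_ge: "right_urn p n y \<ge> base_weight y"
  by (auto simp: right_urn_def)

lemma edge_weight_eq: "edge_weight f \<Delta> p n y = 2 * \<Delta> * (base_weight y + traversals p n y / 2)"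
  using reinforcement_pos by (simp add: edge_weight_def base_weight_def field_simps)

text \<open>At the current position no crossing is pending, so the urn contents are the present edge weights.\<close>

lemma up_prob_urn:
  assumes "p n > 0"
  shows "up_prob f \<Delta> p n = right_urn p n (p n) / (left_urn p n (p n) + right_urn p n (p n))"
proof -
  have l: "left_weight f \<Delta> p n (p n) = 2 * \<Delta> * left_urn p n (p n)"
    using assms by (cases "p n") (auto simp: left_urn_def edge_weight_eq)
  have r: "edge_weight f \<Delta> p n (p n) = 2 * \<Delta> * right_urn p n (p n)"
    by (auto simp: right_urn_def edge_weight_eq)
  show ?thesis unfolding up_prob_def l r
    using reinforcement_pos by (simp flip: distrib_left)
qed

lemma traversals_up:
  "traversals (p(Suc n := p n + 1)) (Suc n) y = traversals p n y + of_bool (y = p n)"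
  unfolding traversals_Suc doubleton_eq_iff by auto

lemma traversals_down:
  assumes "p n > 0"
  shows "traversals (p(Suc n := p n - 1)) (Suc n) y = traversals p n y + of_bool (y + 1 = p n)"
proof -
  have "{p n, p n - 1} = {y, y + 1} \<longleftrightarrow> y + 1 = p n"
    using assms unfolding doubleton_eq_iff by arith
  thus ?thesis unfolding traversals_Suc by simp
qed

text \<open>A step changes only the urn of the vertex that is left: the edge used has now been crossed once and
  will be crossed again before the next visit, a gain of \<open>1/2 + 1/2\<close>.\<close>

lemma urn_up:
  fixes p n defines "p' \<equiv> p(Suc n := p n + 1)"
  assumes "y \<ge> 1"
  shows "left_urn p' (Suc n) y = left_urn p n y"
    and "right_urn p' (Suc n) y = right_urn p n y + of_bool (y = p n)"
proof -
  have e: "p' (Suc n) = p n + 1" by (simp add: p'_def)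
  have y: "y - 1 = p n \<longleftrightarrow> y = p n + 1" using assms(2) by arith
  show "left_urn p' (Suc n) y = left_urn p n y"
    unfolding left_urn_def e unfolding p'_def traversals_up y
    by (cases y "p n + 1" rule: linorder_cases) auto
  show "right_urn p' (Suc n) y = right_urn p n y + of_bool (y = p n)"
    unfolding right_urn_def e unfolding p'_def traversals_up
    by (cases y "p n" rule: linorder_cases) (auto simp: field_simps)
qed

lemma urn_down:
  fixes p n defines "p' \<equiv> p(Suc n := p n - 1)"
  assumes "y \<ge> 1" "p n > 0"
  shows "left_urn p' (Suc n) y = left_urn p n y + of_bool (y = p n)"
    and "right_urn p' (Suc n) y = right_urn p n y"
proof -
  have e: "p' (Suc n) = p n - 1" by (simp add: p'_def)
  have y: "y - 1 + 1 = p n \<longleftrightarrow> y = p n" using assms(2) by arith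
  have y': "y \<le> p n - 1 \<longleftrightarrow> y < p n" "y < p n - 1 \<longleftrightarrow> y + 1 < p n" using assms(3) by arith+
  show "left_urn p' (Suc n) y = left_urn p n y + of_bool (y = p n)"
    unfolding left_urn_def e y' unfolding p'_def traversals_down[of p n, OF assms(3)] y
    by (cases y "p n" rule: linorder_cases) (auto simp: field_simps)
  show "right_urn p' (Suc n) y = right_urn p n y"
    unfolding right_urn_def e y' unfolding p'_def traversals_down[of p n, OF assms(3)]
    by (cases "y + 1" "p n" rule: linorder_cases) auto
qed

text \<open>The conditional expectation, given the history, of the product of the \<open>s\<close>-th powers of the limiting
  odds (left against right) of the urns in \<open>I\<close>.\<close>

definition urn_mart :: "real \<Rightarrow> nat set \<Rightarrow> nat \<Rightarrow> (nat \<Rightarrow> nat) \<Rightarrow> real" where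
  "urn_mart s I n p = (\<Prod>y\<in>I. Gamma_ratio s (left_urn p n y) * Gamma_ratio (- s) (right_urn p n y))"

lemma urn_mart_up:
  fixes p n defines "p' \<equiv> p(Suc n := p n + 1)"
  assumes "0 \<notin> I" "finite I"
  shows "p n \<notin> I \<Longrightarrow> urn_mart s I (Suc n) p' = urn_mart s I n p"
    and "p n \<in> I \<Longrightarrow> right_urn p n (p n) > 0 \<Longrightarrow> right_urn p n (p n) > s \<Longrightarrow>
      urn_mart s I (Suc n) p' = (right_urn p n (p n) - s) / right_urn p n (p n) * urn_mart s I n p"
proof -
  have ge1: "y \<ge> 1" if "y \<in> I" for y
    using assms(2) that by (cases y) auto
  have *: "urn_mart s J (Suc n) p' = urn_mart s J n p" if "J \<subseteq> I" "p n \<notin> J" for J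
    unfolding urn_mart_def
  proof (rule prod.cong)
    fix y assume y: "y \<in> J"
    with that have "y \<ge> 1" "y \<noteq> p n" using ge1 by auto
    thus "Gamma_ratio s (left_urn p' (Suc n) y) * Gamma_ratio (- s) (right_urn p' (Suc n) y) =
         Gamma_ratio s (left_urn p n y) * Gamma_ratio (- s) (right_urn p n y)"
      using urn_up[of y p n, folded p'_def] by simp
  qed auto
  show "p n \<notin> I \<Longrightarrow> urn_mart s I (Suc n) p' = urn_mart s I n p" using * by blast
  assume x: "p n \<in> I" and r: "right_urn p n (p n) > 0" "right_urn p n (p n) > s"
  have split: "urn_mart s I k q = Gamma_ratio s (left_urn q k (p n)) * Gamma_ratio (- s) (right_urn q k (p n))
                 * urn_mart s (I - {p n}) k q" for k q
    unfolding urn_mart_def using x assms(3) by (subst prod.remove[of _ "p n"]) auto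
  have "urn_mart s (I - {p n}) (Suc n) p' = urn_mart s (I - {p n}) n p" by (rule *) auto
  moreover have "left_urn p' (Suc n) (p n) = left_urn p n (p n)"
    "right_urn p' (Suc n) (p n) = right_urn p n (p n) + 1"
    using urn_up[of "p n" p n, folded p'_def] ge1[OF x] by auto
  ultimately show "urn_mart s I (Suc n) p' = (right_urn p n (p n) - s) / right_urn p n (p n) * urn_mart s I n p"
    using Gamma_ratio_plus1[of "right_urn p n (p n)" "- s"] r
    by (simp add: split[of "Suc n" p'] split[of n p])
qed

lemma urn_mart_down:
  fixes p n defines "p' \<equiv> p(Suc n := p n - 1)"
  assumes "0 \<notin> I" "finite I" "p n > 0"
  shows "p n \<notin> I \<Longrightarrow> urn_mart s I (Suc n) p' = urn_mart s I n p"
    and "p n \<in> I \<Longrightarrow> left_urn p n (p n) > 0 \<Longrightarrow> left_urn p n (p n) > - s \<Longrightarrow>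
      urn_mart s I (Suc n) p' = (left_urn p n (p n) + s) / left_urn p n (p n) * urn_mart s I n p"
proof -
  have ge1: "y \<ge> 1" if "y \<in> I" for y
    using assms(2) that by (cases y) auto
  have *: "urn_mart s J (Suc n) p' = urn_mart s J n p" if "J \<subseteq> I" "p n \<notin> J" for J
    unfolding urn_mart_def
  proof (rule prod.cong)
    fix y assume y: "y \<in> J"
    with that have "y \<ge> 1" "y \<noteq> p n" using ge1 by auto
    thus "Gamma_ratio s (left_urn p' (Suc n) y) * Gamma_ratio (- s) (right_urn p' (Suc n) y) =
         Gamma_ratio s (left_urn p n y) * Gamma_ratio (- s) (right_urn p n y)"
      using urn_down[of y p n, folded p'_def] assms(4) by simp
  qed auto
  show "p n \<notin> I \<Longrightarrow> urn_mart s I (Suc n) p' = urn_mart s I n p" using * by blast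
  assume x: "p n \<in> I" and r: "left_urn p n (p n) > 0" "left_urn p n (p n) > - s"
  have split: "urn_mart s I k q = Gamma_ratio s (left_urn q k (p n)) * Gamma_ratio (- s) (right_urn q k (p n))
                 * urn_mart s (I - {p n}) k q" for k q
    unfolding urn_mart_def using x assms(3) by (subst prod.remove[of _ "p n"]) auto
  have "urn_mart s (I - {p n}) (Suc n) p' = urn_mart s (I - {p n}) n p" by (rule *) auto
  moreover have "right_urn p' (Suc n) (p n) = right_urn p n (p n)"
    "left_urn p' (Suc n) (p n) = left_urn p n (p n) + 1"
    using urn_down[of "p n" p n, folded p'_def] ge1[OF x] assms(4) by auto
  ultimately show "urn_mart s I (Suc n) p' = (left_urn p n (p n) + s) / left_urn p n (p n) * urn_mart s I n p"
    using Gamma_ratio_plus1[of "left_urn p n (p n)" "s"] r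
    by (simp add: split[of "Suc n" p'] split[of n p])
qed

text \<open>Only the factor of the current vertex changes. By the recursion for \<open>Gamma_ratio\<close> it is multiplied by
  \<open>(r - s) / r\<close> with probability \<open>r / (l + r)\<close> and by \<open>(l + s) / l\<close> with probability \<open>l / (l + r)\<close>; the
  mean of the two is \<open>1\<close>. Vertex \<open>0\<close> has no left edge and must stay outside \<open>I\<close>.\<close>

lemma urn_mart_step:
  assumes p: "p \<in> paths n" and I: "finite I" "0 \<notin> I"
    and s: "\<And>y. y \<in> I \<Longrightarrow> \<bar>s\<bar> < base_weight y" "\<bar>s\<bar> < 1/2"
  shows "up_prob f \<Delta> p n * urn_mart s I (Suc n) (p(Suc n := p n + 1))
     + (1 - up_prob f \<Delta> p n) * urn_mart s I (Suc n) (p(Suc n := p n - 1)) = urn_mart s I n p"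
    (is "?u * ?U + (1 - ?u) * ?D = ?M")
proof (cases "p n \<in> I")
  case False
  have U: "?U = ?M" by (rule urn_mart_up(1)[where p = p and n = n, OF I(2,1) False])
  show ?thesis
  proof (cases "p n = 0")
    case True
    have "?u = 1" by (rule up_prob_0) (rule True)
    thus ?thesis unfolding U by simp
  next
    case pos: False
    hence "?D = ?M" by (intro urn_mart_down(1)[where p = p and n = n, OF I(2,1) _ False]) auto
    thus ?thesis unfolding U by (simp add: algebra_simps)
  qed
next
  case True
  define l where "l = left_urn p n (p n)"
  define r where "r = right_urn p n (p n)"
  have pos: "p n > 0" "p n \<ge> 1" using True I(2) by (cases "p n"; auto)+
  have l: "l > 0" "l > - s" using left_urn_ge_half[OF p pos(2)] s(2) by (auto simp: l_def)
  have r: "r > 0" "r > s" using right_urn_ge[of "p n" p n] s(1)[OF True] by (auto simp: r_def)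
  have U: "?U = (r - s) / r * ?M"
    unfolding r_def by (rule urn_mart_up(2)[where p = p and n = n, OF I(2,1) True]) (use r in \<open>auto simp: r_def\<close>)
  have D: "?D = (l + s) / l * ?M"
    unfolding l_def by (rule urn_mart_down(2)[where p = p and n = n, OF I(2,1) pos(1) True]) (use l in \<open>auto simp: l_def\<close>)
  have u: "?u = r / (l + r)" unfolding l_def r_def by (rule up_prob_urn) (rule pos(1))
  have "1 - r / (l + r) = l / (l + r)" using l r by (simp add: field_simps)
  hence "?u * ?U + (1 - ?u) * ?D = r / (l + r) * ((r - s) / r * ?M) + l / (l + r) * ((l + s) / l * ?M)"
    by (simp only: U D u)
  also have "\<dots> = (r - s) / (l + r) * ?M + (l + s) / (l + r) * ?M"
    using l r by simp
  also have "\<dots> = ((r - s) + (l + s)) / (l + r) * ?M" by (simp only: add_divide_distrib distrib_right)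
  also have "(r - s) + (l + s) = l + r" by simp
  also have "(l + r) / (l + r) * ?M = ?M" using l r by simp
  finally show ?thesis .
qed

lemma urn_mart_expect:
  assumes "finite I" "0 \<notin> I" "\<And>y. y \<in> I \<Longrightarrow> \<bar>s\<bar> < base_weight y" "\<bar>s\<bar> < 1/2"
  shows "expect n (urn_mart s I n) = urn_mart s I 0 (\<lambda>_. 0)"
  using assms by (intro expect_martingale urn_mart_step) auto

lemma urn_start:
  "y \<ge> 1 \<Longrightarrow> left_urn (\<lambda>_. 0) 0 y = base_weight (y - 1) + 1/2"
  "right_urn (\<lambda>_. 0) 0 y = base_weight y"
  by (auto simp: left_urn_def right_urn_def)

section \<open>Reaching a level early\<close>

lemma urn_cong:
  assumes "\<And>i. i \<le> n \<Longrightarrow> p i = q i"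
  shows "left_urn p n y = left_urn q n y" "right_urn p n y = right_urn q n y"
  using traversals_cong[of n p q] assms by (auto simp: left_urn_def right_urn_def)

lemma urn_mart_cong: "(\<And>i. i \<le> n \<Longrightarrow> p i = q i) \<Longrightarrow> urn_mart s I n p = urn_mart s I n q"
  unfolding urn_mart_def using urn_cong[of n p q] by simp

text \<open>Optional stopping at the first visit to \<open>N\<close>: freezing the product at that time preserves the
  martingale equation.\<close>

lemma urn_mart_stopped:
  assumes "finite I" "0 \<notin> I" "\<And>y. y \<in> I \<Longrightarrow> \<bar>s\<bar> < base_weight y" "\<bar>s\<bar> < 1/2"
  shows "expect n (\<lambda>p. urn_mart s I (stop_time N n p) p) = urn_mart s I 0 (\<lambda>_. 0)"
proof -
  have "expect n (\<lambda>p. urn_mart s I (stop_time N n p) p) =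
        (\<lambda>p. urn_mart s I (stop_time N 0 p) p) (\<lambda>_. 0)"
  proof (rule expect_martingale)
    fix n p assume p: "p \<in> paths n"
    let ?F = "\<lambda>n p. urn_mart s I (stop_time N n p) p"
    have tau: "stop_time N n (p(Suc n := a)) = stop_time N n p" for a
      by (intro stop_time_cong) simp
    have le: "stop_time N n p \<le> n" by (rule stop_time_le)
    show "up_prob f \<Delta> p n * ?F (Suc n) (p(Suc n := p n + 1))
       + (1 - up_prob f \<Delta> p n) * ?F (Suc n) (p(Suc n := p n - 1)) = ?F n p"
    proof (cases "p (stop_time N n p) = N")
      case True
      have "?F (Suc n) (p(Suc n := a)) = ?F n p" for a
      proof -
        have "stop_time N (Suc n) (p(Suc n := a)) = stop_time N n p"
          using True le by (simp add: tau)
        moreover have "urn_mart s I (stop_time N n p) (p(Suc n := a)) = urn_mart s I (stop_time N n p) p"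
          using le by (intro urn_mart_cong) auto
        ultimately show ?thesis by (simp only:)
      qed
      thus ?thesis by (simp only:) (simp add: algebra_simps)
    next
      case False
      hence n: "stop_time N n p = n" by (rule stop_time_not_hit)
      have "stop_time N (Suc n) (p(Suc n := a)) = Suc n" for a
        using False le by (simp add: tau)
      thus ?thesis using urn_mart_step[OF p assms] by (simp only: n)
    qed
  qed
  thus ?thesis by simp
qed

lemma urn_mart_pos:
  assumes "p \<in> paths n" "0 \<notin> I" "\<And>y. y \<in> I \<Longrightarrow> \<bar>s\<bar> < base_weight y" "\<bar>s\<bar> < 1/2"
  shows "urn_mart s I n p > 0"
  unfolding urn_mart_def
proof (intro prod_pos mult_pos_pos Gamma_ratio_pos)
  fix y assume y: "y \<in> I"
  hence "y \<ge> 1" using assms(2) by (cases y) auto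
  thus "left_urn p n y > 0" "left_urn p n y + s > 0"
    using left_urn_ge_half[OF assms(1), of y] assms(4) by auto
  show "right_urn p n y > 0" "right_urn p n y + - s > 0"
    using right_urn_ge[of y p n] assms(3)[OF y] by auto
qed

text \<open>When the walk stands at \<open>N\<close>, every edge below \<open>N\<close> has content \<open>v\<close> seen from its upper and \<open>v + 1/2\<close>
  seen from its lower endpoint. The factors of the inner edges are then at least \<open>1\<close>. What remains is
  the edge \<open>{0, 1}\<close>, whose content is at most linear in the elapsed time.\<close>

lemma urn_mart_at_hit:
  fixes k N :: nat
  assumes p: "p \<in> paths k" "p k = N" and N: "N \<ge> 2"
    and s: "0 < s" "s \<le> 1/4" "\<And>y. y < N \<Longrightarrow> s < base_weight y"
  shows "urn_mart (- s) {1..<N} k p \<ge> 1/3 * (base_weight 0 + k / 2) powr (- s)"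
proof -
  define v where "v = (\<lambda>y. base_weight y + traversals p k y / 2)"
  have v: "v y \<ge> base_weight y" for y by (simp add: v_def)
  let ?A = "\<lambda>y. Gamma_ratio (- s) (v y)" and ?B = "\<lambda>y. Gamma_ratio s (v y + 1/2)"
  have v': "v y > s" if "y < N" for y using s(3)[OF that] v[of y] by simp
  have "urn_mart (- s) {1..<N} k p = (\<Prod>y\<in>{1..<N}. ?A (y - 1) * ?B y)"
    unfolding urn_mart_def using p(2)
    by (intro prod.cong refl) (auto simp: left_urn_def right_urn_def v_def)
  also have "\<dots> = ?A 0 * (\<Prod>y\<in>{1..<N - 1}. ?B y * ?A y) * ?B (N - 1)"
    using N by (subst prod_shift) auto
  also have "\<dots> \<ge> ?A 0 * 1 * (1/3)"
  proof (intro mult_mono)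
    show "1 \<le> (\<Prod>y\<in>{1..<N - 1}. ?B y * ?A y)"
      using s v' by (intro prod_ge_1 Gamma_ratio_pair_ge1) auto
    show "1/3 \<le> ?B (N - 1)"
      using v'[of "N - 1"] N s by (intro Gamma_ratio_ge_third) auto
    have pos: "?A y \<ge> 0" "?B y \<ge> 0" if "y < N" for y
      using v'[OF that] s by (auto intro!: less_imp_le[OF Gamma_ratio_pos])
    show "0 \<le> ?A 0" using pos N by simp
    thus "0 \<le> ?A 0 * (\<Prod>y\<in>{1..<N - 1}. ?B y * ?A y)"
      using pos by (intro mult_nonneg_nonneg prod_nonneg) auto
  qed auto
  finally have 1: "?A 0 * (1/3) \<le> urn_mart (- s) {1..<N} k p" by simp
  have "traversals p k 0 \<le> k" by (rule traversals_le)
  hence "v 0 \<le> base_weight 0 + k / 2" by (simp add: v_def)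
  moreover have "v 0 > 0" using v'[of 0] s N by simp
  ultimately have "(base_weight 0 + k / 2) powr (- s) \<le> v 0 powr (- s)"
    using s by (intro powr_mono2') auto
  also have "\<dots> \<le> ?A 0" using v'[of 0] s N by (intro Gamma_ratio_neg_ge_powr) auto
  finally show ?thesis using 1 by simp
qed

text \<open>At time \<open>0\<close> the roles of the endpoints are exchanged: the content of an edge is \<open>b\<close> seen from below
  and \<open>b + 1/2\<close> seen from above, and the factors are small instead of large.\<close>

lemma urn_mart_start_down:
  fixes N :: nat
  assumes N: "N \<ge> 2" and s: "0 < s" "s \<le> 1/4" "\<And>y. y < N \<Longrightarrow> s < base_weight y"
  shows "urn_mart (- s) {1..<N} 0 (\<lambda>_. 0) \<le> 4 * (1 + base_weight (N - 1)) *
     exp (- s * (\<Sum>y\<in>{1..<N - 1}. Digamma (base_weight y + 1/2 - s) - Digamma (base_weight y + s)))"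
proof -
  let ?A = "\<lambda>y. Gamma_ratio (- s) (base_weight y + 1/2)" and ?B = "\<lambda>y. Gamma_ratio s (base_weight y)"
  let ?E = "exp (- s * (\<Sum>y\<in>{1..<N - 1}. Digamma (base_weight y + 1/2 - s) - Digamma (base_weight y + s)))"
  have pos: "?A y > 0" "?B y > 0" for y
    using s base_weight_pos[of y] by (auto intro!: Gamma_ratio_pos)
  have "urn_mart (- s) {1..<N} 0 (\<lambda>_. 0) = (\<Prod>y\<in>{1..<N}. ?A (y - 1) * ?B y)"
    unfolding urn_mart_def by (intro prod.cong refl) (simp add: urn_start)
  also have "\<dots> = ?A 0 * (\<Prod>y\<in>{1..<N - 1}. ?B y * ?A y) * ?B (N - 1)"
    using N by (subst prod_shift) auto
  also have "\<dots> \<le> 4 * ?E * (1 + base_weight (N - 1))"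
  proof (intro mult_mono)
    show "?A 0 \<le> 4" using s base_weight_pos[of 0] by (intro Gamma_ratio_neg_le) auto
    have "?B (N - 1) \<le> base_weight (N - 1) powr s" using s base_weight_pos by (intro Gamma_ratio_le_powr) auto
    also have "\<dots> \<le> 1 + base_weight (N - 1)" using s base_weight_pos by (intro powr_le_1_plus) auto
    finally show "?B (N - 1) \<le> 1 + base_weight (N - 1)" .
    have "(\<Prod>y\<in>{1..<N - 1}. ?B y * ?A y)
        \<le> (\<Prod>y\<in>{1..<N - 1}. exp (- s * (Digamma (base_weight y + 1/2 - s) - Digamma (base_weight y + s))))"
    proof (intro prod_mono conjI)
      fix y assume "y \<in> {1..<N - 1}"
      thus "?B y * ?A y \<le> exp (- s * (Digamma (base_weight y + 1/2 - s) - Digamma (base_weight y + s)))"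
        using s by (intro Gamma_ratio_pair_le_down) auto
      show "0 \<le> ?B y * ?A y" using pos[of y] by simp
    qed
    also have "\<dots> = ?E" by (simp add: exp_sum sum_distrib_left)
    finally show "(\<Prod>y\<in>{1..<N - 1}. ?B y * ?A y) \<le> ?E" .
    have "?B y * ?A y \<ge> 0" for y using pos[of y] by simp
    thus P: "0 \<le> (\<Prod>y\<in>{1..<N - 1}. ?B y * ?A y)" by (intro prod_nonneg)
    show "0 \<le> ?B (N - 1)" using pos[of "N - 1"] by simp
  qed auto
  finally show ?thesis by (simp only: mult_ac)
qed

text \<open>The stopped product has expectation \<open>urn_mart (-s) {1..<N} 0\<close>, and on the event in question it is
  at least of order \<open>t powr -s\<close>.\<close>

theorem prob_hit_early:
  fixes N t :: nat
  assumes N: "N \<ge> 2" and s: "0 < s" "s \<le> 1/4" "\<And>y. y < N \<Longrightarrow> s < base_weight y"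
  shows "prob {\<omega>\<in>space M. \<exists>k\<le>t. X k \<omega> = N} \<le> 12 * (1 + base_weight (N - 1)) * (base_weight 0 + t / 2) powr s *
     exp (- s * (\<Sum>y\<in>{1..<N - 1}. Digamma (base_weight y + 1/2 - s) - Digamma (base_weight y + s)))"
proof -
  let ?I = "{1..<N}"
  let ?F = "\<lambda>p. urn_mart (- s) ?I (stop_time N t p) p"
  \<comment> \<open>The bound of \<open>urn_mart_at_hit\<close> at the latest possible time \<open>t\<close>.\<close>
  define c where "c = 1/3 * (base_weight 0 + t / 2) powr (- s)"
  have b0: "base_weight 0 + t / 2 > 0" using base_weight_pos[of 0] by (simp add: add_pos_nonneg)
  have c: "c > 0" using b0 by (simp add: c_def)
  have tr: "\<exists>q\<in>paths (stop_time N t p). \<forall>i\<le>stop_time N t p. q i = p i" if "p \<in> paths t" for p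
    using paths_truncate[OF that stop_time_le[of N t p]] by (intro bexI[rotated]) auto
  have "prob {\<omega>\<in>space M. \<exists>k\<le>t. X k \<omega> = N} \<le> expect t ?F / c"
  proof (rule markov_paths)
    fix p assume p: "p \<in> paths t"
    then obtain q where q: "q \<in> paths (stop_time N t p)" "\<And>i. i \<le> stop_time N t p \<Longrightarrow> q i = p i"
      using tr by blast
    have Fq: "?F p = urn_mart (- s) ?I (stop_time N t p) q"
      using q(2) by (intro urn_mart_cong) auto
    have "urn_mart (- s) ?I (stop_time N t p) q > 0"
      using s by (intro urn_mart_pos q) auto
    thus "?F p \<ge> 0" unfolding Fq by simp
    assume "\<exists>k\<le>t. p k = N"
    hence "p (stop_time N t p) = N" using stop_time_hit by blast
    hence qN: "q (stop_time N t p) = N" using q(2) by simp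
    have "c \<le> 1/3 * (base_weight 0 + stop_time N t p / 2) powr (- s)"
      unfolding c_def using stop_time_le[of N t p] base_weight_pos[of 0] s
      by (intro mult_left_mono powr_mono2') (auto simp: add_pos_nonneg)
    also have "\<dots> \<le> urn_mart (- s) ?I (stop_time N t p) q"
      by (intro urn_mart_at_hit q qN N s)
    finally show "c \<le> ?F p" unfolding Fq .
  next
    fix p q :: "nat \<Rightarrow> nat" assume "\<And>i. i \<le> t \<Longrightarrow> p i = q i"
    thus "(\<exists>k\<le>t. p k = N) = (\<exists>k\<le>t. q k = N)" by metis
  qed (use c in measurable)
  also have "expect t ?F = urn_mart (- s) ?I 0 (\<lambda>_. 0)"
    using s by (intro urn_mart_stopped) auto
  also have "\<dots> / c \<le> 4 * (1 + base_weight (N - 1)) *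
     exp (- s * (\<Sum>y\<in>{1..<N - 1}. Digamma (base_weight y + 1/2 - s) - Digamma (base_weight y + s))) / c"
    using c by (intro divide_right_mono urn_mart_start_down N s) auto
  finally show ?thesis using b0 by (simp add: c_def powr_minus field_simps)
qed

section \<open>Reaching a level late\<close>

text \<open>In the random environment let \<open>\<rho>\<^sub>y\<close> be the odds of going left at \<open>y\<close>. The expected number of downward
  crossings of \<open>{i - 1, i}\<close> before reaching \<open>N\<close> is \<open>\<Sum>\<^sub>j \<rho>\<^sub>i \<dots> \<rho>\<^sub>j\<close>, and its \<open>s\<close>-th power is at most
  \<open>\<Sum>\<^sub>j (\<rho>\<^sub>i \<dots> \<rho>\<^sub>j) powr s\<close> for \<open>s \<le> 1\<close>. Up to the empty product and the last coefficient this is the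
  sum whose conditional expectation is taken here. The last summand is enlarged by a power of the weight
  of the edge \<open>{N - 1, N}\<close>, which starts the downward induction in \<open>urn_sum_tail_ge\<close>.\<close>

definition urn_sum :: "real \<Rightarrow> nat \<Rightarrow> nat \<Rightarrow> nat \<Rightarrow> (nat \<Rightarrow> nat) \<Rightarrow> real" where
  "urn_sum s N i n p =
     (\<Sum>j\<in>{i..N}. (if j = N then 1 + base_weight (N - 1) powr s else 1) * urn_mart s {i..<j} n p)"

lemma urn_sum_last: "urn_sum s N N n p = 1 + base_weight (N - 1) powr s"
  by (simp add: urn_sum_def urn_mart_def)

lemma urn_sum_rec:
  assumes "i < N"
  shows "urn_sum s N i n p =
    1 + Gamma_ratio s (left_urn p n i) * Gamma_ratio (- s) (right_urn p n i) * urn_sum s N (Suc i) n p"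
proof -
  let ?c = "\<lambda>j. if j = N then 1 + base_weight (N - 1) powr s else 1"
  let ?Z = "Gamma_ratio s (left_urn p n i) * Gamma_ratio (- s) (right_urn p n i)"
  have "urn_sum s N i n p = ?c i * urn_mart s {i..<i} n p + (\<Sum>j\<in>{Suc i..N}. ?c j * urn_mart s {i..<j} n p)"
    unfolding urn_sum_def using assms by (subst sum.atLeast_Suc_atMost) auto
  also have "(\<Sum>j\<in>{Suc i..N}. ?c j * urn_mart s {i..<j} n p) =
             (\<Sum>j\<in>{Suc i..N}. ?Z * (?c j * urn_mart s {Suc i..<j} n p))"
  proof (intro sum.cong refl)
    fix j assume "j \<in> {Suc i..N}"
    hence "urn_mart s {i..<j} n p = ?Z * urn_mart s {Suc i..<j} n p"
      unfolding urn_mart_def by (subst prod.atLeast_Suc_lessThan) auto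
    thus "?c j * urn_mart s {i..<j} n p = ?Z * (?c j * urn_mart s {Suc i..<j} n p)"
      by (simp only: mult_ac)
  qed
  also have "\<dots> = ?Z * urn_sum s N (Suc i) n p"
    by (simp only: urn_sum_def sum_distrib_left)
  finally show ?thesis using assms by (simp add: urn_mart_def)
qed

text \<open>Downward induction on \<open>i\<close>. The summand \<open>1\<close> in the recursion \<open>urn_sum_rec\<close> supplies, at each vertex,
  the additive slack required by \<open>Gamma_ratio_compensate\<close>. At the last vertex the edge to \<open>N\<close> still has
  its initial weight because \<open>N\<close> has not been reached.\<close>

lemma urn_sum_tail_ge:
  assumes p: "p \<in> paths n" "\<And>k. k \<le> n \<Longrightarrow> p k < N"
    and s: "0 < s" "s \<le> 1/4" "\<And>y. y < N \<Longrightarrow> s < base_weight y"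
    and i: "1 \<le> i" "i < N"
  shows "Gamma_ratio (- s) (right_urn p n i) * urn_sum s N (Suc i) n p \<ge> 1/2"
  using i
proof (induction "N - i" arbitrary: i)
  case (Suc m i)
  have rpos: "right_urn p n i > s" using right_urn_ge[of i p n] s(3)[OF Suc.prems(2)] by simp
  have q: "Gamma_ratio (- s) (right_urn p n i) > 0" using rpos s by (intro Gamma_ratio_pos) auto
  show ?case
  proof (cases "Suc i = N")
    case True
    have "traversals p n i = 0" using p(2) True by (intro traversals_eq_0) fastforce
    moreover have "\<not> i < p n" using p(2)[of n] True by simp
    ultimately have r: "right_urn p n i = base_weight i" by (simp add: right_urn_def)
    have "base_weight i powr (- s) \<le> Gamma_ratio (- s) (base_weight i)"
      using rpos r s by (intro Gamma_ratio_neg_ge_powr) auto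
    hence "base_weight i powr (- s) * (1 + base_weight i powr s) \<le> Gamma_ratio (- s) (base_weight i) * (1 + base_weight i powr s)"
      by (intro mult_right_mono) auto
    moreover have "base_weight i powr (- s) * (1 + base_weight i powr s) = base_weight i powr (- s) + 1"
      using base_weight_pos[of i] by (simp add: powr_minus field_simps)
    ultimately have "1 \<le> Gamma_ratio (- s) (base_weight i) * (1 + base_weight i powr s)" using base_weight_pos[of i] 
      by (smt (verit) powr_ge_zero)
    moreover have "N - 1 = i" using True by simp
    ultimately show ?thesis unfolding r True urn_sum_last by simp
  next
    case False
    hence i': "Suc i < N" using Suc.prems by simp
    let ?e = "Gamma_ratio s (left_urn p n (Suc i))"
    have l: "left_urn p n (Suc i) \<ge> 1/2" using left_urn_ge_half[OF p(1)] by simp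
    have e: "?e > 0" using l s by (intro Gamma_ratio_pos) auto
    have IH: "Gamma_ratio (- s) (right_urn p n (Suc i)) * urn_sum s N (Suc (Suc i)) n p \<ge> 1/2"
      using Suc.hyps(2) i' by (intro Suc.hyps(1)) auto
    have "urn_sum s N (Suc i) n p = 1 + ?e * (Gamma_ratio (- s) (right_urn p n (Suc i)) * urn_sum s N (Suc (Suc i)) n p)"
      using urn_sum_rec[OF i', of s n p] by (simp only: mult.assoc)
    also have "\<dots> \<ge> 1 + ?e * (1/2)" using IH e by (intro add_left_mono mult_left_mono) auto
    finally have 1: "1/2 * (2 + ?e) \<le> urn_sum s N (Suc i) n p" by simp
    have "1 / Gamma_ratio (- s) (right_urn p n i) \<le> 2 + ?e"
      using l rpos s by (intro Gamma_ratio_compensate) (auto simp: left_urn_def right_urn_def)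
    with 1 have "1/2 * (1 / Gamma_ratio (- s) (right_urn p n i)) \<le> urn_sum s N (Suc i) n p" by simp
    thus ?thesis using q by (simp add: field_simps)
  qed
qed simp

text \<open>By \<open>urn_sum_tail_ge\<close> the factors other than \<open>Gamma_ratio s (left_urn p n i)\<close> contribute at least
  \<open>1/2\<close>, and this one is comparable to a power of the weight of the left edge of \<open>i\<close>.\<close>

lemma urn_sum_ge:
  assumes p: "p \<in> paths n" "\<And>k. k \<le> n \<Longrightarrow> p k < N"
    and s: "0 < s" "s \<le> 1/4" "\<And>y. y < N \<Longrightarrow> s < base_weight y"
    and i: "1 \<le> i" "i < N"
  shows "urn_sum s N i n p \<ge> 1/3 * (traversals p n (i - 1) / 2) powr s"
proof -
  let ?l = "left_urn p n i"
  have l: "?l \<ge> 1/2" using left_urn_ge_half[OF p(1)] i by simp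
  have "traversals p n (i - 1) / 2 \<le> ?l + s" using base_weight_pos[of "i - 1"] s by (simp add: left_urn_def)
  hence "(traversals p n (i - 1) / 2) powr s \<le> (?l + s) powr s"
    using s by (intro powr_mono2) auto
  hence "1/3 * (traversals p n (i - 1) / 2) powr s \<le> 1/3 * (?l + s) powr s" by simp
  also have "\<dots> \<le> (1/2 * (?l / (?l + s))) * (?l + s) powr s"
    using l s by (intro mult_right_mono) (auto simp: field_simps)
  also have "\<dots> = 1/2 * (?l / (?l + s) * (?l + s) powr s)" by simp
  also have "\<dots> \<le> 1/2 * Gamma_ratio s ?l"
    using l s by (intro mult_left_mono Gamma_ratio_ge_powr) auto
  also have "\<dots> \<le> Gamma_ratio s ?l * (Gamma_ratio (- s) (right_urn p n i) * urn_sum s N (Suc i) n p)"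
  proof -
    have "Gamma_ratio s ?l > 0" using l s by (intro Gamma_ratio_pos) auto
    thus ?thesis using urn_sum_tail_ge[OF p s i]
      by (subst mult.commute) (intro mult_left_mono, auto)
  qed
  also have "\<dots> \<le> urn_sum s N i n p" unfolding urn_sum_rec[OF i(2)] by (simp add: mult.assoc)
  finally show ?thesis .
qed

text \<open>All edge factors are at least \<open>1\<close>, so the product over any block is bounded by the one over
  \<open>{1..<N}\<close>; the two boundary factors are at most \<open>\<beta> + 2\<close> and \<open>8\<close>.\<close>

lemma urn_mart_start_up:
  fixes \<beta> :: real and N i j :: nat
  assumes s: "0 < s" "s \<le> 1/4" "\<And>y. y < N \<Longrightarrow> s \<le> base_weight y / 2" "\<And>y. y < N \<Longrightarrow> base_weight y \<le> \<beta>"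
    and ij: "1 \<le> i" "i \<le> j" "j \<le> N"
  shows "urn_mart s {i..<j} 0 (\<lambda>_. 0) \<le> 8 * (\<beta> + 2) *
     exp (s * (\<Sum>y\<in>{1..<N}. Digamma (base_weight y + 1/2 + s) - Digamma (base_weight y - s)))"
proof -
  let ?A = "\<lambda>y. Gamma_ratio s (base_weight y + 1/2)" and ?B = "\<lambda>y. Gamma_ratio (- s) (base_weight y)"
  let ?D = "\<lambda>y. Digamma (base_weight y + 1/2 + s) - Digamma (base_weight y - s)"
  let ?E = "exp (s * (\<Sum>y\<in>{1..<N}. ?D y))"
  have sb: "s < base_weight y" if "y < N" for y using s(3)[OF that] base_weight_pos[of y] by linarith
  have pos: "?A y > 0" "?B y > 0" if "y < N" for y
    using s(1) base_weight_pos[of y] sb[OF that] by (auto intro!: Gamma_ratio_pos)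
  have D: "?D y \<ge> 0" if "y < N" for y
    using Digamma_real_mono[of "base_weight y - s" "base_weight y + 1/2 + s"] sb[OF that] s by auto
  have "0 \<le> s * (\<Sum>y\<in>{1..<N}. ?D y)" using D s by (intro mult_nonneg_nonneg sum_nonneg) auto
  hence E: "?E \<ge> 1" by simp
  have "\<beta> \<ge> 0 \<or> N = 0" using s(4)[of 0] base_weight_pos[of 0] by linarith
  hence \<beta>: "\<beta> \<ge> 0" using ij by auto
  show ?thesis
  proof (cases "i = j")
    case True
    have "1 * 1 \<le> (8 * (\<beta> + 2)) * ?E" using E \<beta> by (intro mult_mono) auto
    thus ?thesis using True by (simp add: urn_mart_def)
  next
    case False
    hence ij': "i < j" using ij by simp
    have "urn_mart s {i..<j} 0 (\<lambda>_. 0) = (\<Prod>y\<in>{i..<j}. ?A (y - 1) * ?B y)"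
      unfolding urn_mart_def using ij by (intro prod.cong refl) (simp add: urn_start)
    also have "\<dots> = ?A (i - 1) * (\<Prod>y\<in>{i..<j - 1}. ?B y * ?A y) * ?B (j - 1)"
      using ij' ij by (intro prod_shift) auto
    also have "\<dots> \<le> (\<beta> + 2) * ?E * 8"
    proof (intro mult_mono)
      have "?A (i - 1) \<le> (base_weight (i - 1) + 1/2) powr s" using s base_weight_pos[of "i - 1"]
        by (intro Gamma_ratio_le_powr) auto
      also have "\<dots> \<le> 1 + (base_weight (i - 1) + 1/2)" using s base_weight_pos[of "i - 1"] by (intro powr_le_1_plus) auto
      also have "\<dots> \<le> \<beta> + 2" using s(4)[of "i - 1"] ij ij' by (simp add: less_imp_diff_less)
      finally show "?A (i - 1) \<le> \<beta> + 2" .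
      show "?B (j - 1) \<le> 8" using s base_weight_pos ij ij' by (intro Gamma_ratio_neg_le_small) auto
      have "(\<Prod>y\<in>{i..<j - 1}. ?B y * ?A y) \<le> (\<Prod>y\<in>{i..<j - 1}. exp (s * ?D y))"
      proof (intro prod_mono conjI)
        fix y assume y: "y \<in> {i..<j - 1}"
        show "?B y * ?A y \<le> exp (s * ?D y)"
          using s sb[of y] y ij by (intro Gamma_ratio_pair_le_up) auto
        have "y < N" using y ij by auto
        thus "0 \<le> ?B y * ?A y" using pos[of y] by simp
      qed
      also have "\<dots> = exp (s * (\<Sum>y\<in>{i..<j - 1}. ?D y))" by (simp add: exp_sum sum_distrib_left)
      also have "\<dots> \<le> ?E" unfolding exp_le_cancel_iff using s D ij
        by (intro mult_left_mono sum_mono2) auto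
      finally show "(\<Prod>y\<in>{i..<j - 1}. ?B y * ?A y) \<le> ?E" .
      have "?B y * ?A y \<ge> 0" if "y \<in> {i..<j - 1}" for y
      proof -
        have "y < N" using that ij by auto
        thus ?thesis using pos[of y] by simp
      qed
      thus "0 \<le> (\<Prod>y\<in>{i..<j - 1}. ?B y * ?A y)" by (intro prod_nonneg)
      have "j - 1 < N" using ij ij' by linarith
      thus "0 \<le> ?B (j - 1)" using pos[of "j - 1"] by simp
    qed (use \<beta> in auto)
    finally show ?thesis by (simp only: mult_ac)
  qed
qed

text \<open>As long as the walk stays below \<open>N\<close>, its \<open>n\<close> steps are spread over fewer than \<open>N\<close> edges. So one of
  them has been crossed at least \<open>n / N\<close> times, which makes the sum of all \<open>urn_sum\<close> large.\<close>

theorem prob_hit_late: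
  fixes N n :: nat and \<beta> :: real
  assumes N: "N \<ge> 2" and n: "n \<ge> 1"
    and s: "0 < s" "s \<le> 1/4" "\<And>y. y < N \<Longrightarrow> s \<le> base_weight y / 2" "\<And>y. y < N \<Longrightarrow> base_weight y \<le> \<beta>"
  shows "prob {\<omega>\<in>space M. \<forall>k\<le>n. X k \<omega> \<noteq> N} \<le> 24 * N\<^sup>2 * (\<beta> + 2)\<^sup>2 * (2 * N / n) powr s *
     exp (s * (\<Sum>y\<in>{1..<N}. Digamma (base_weight y + 1/2 + s) - Digamma (base_weight y - s)))"
proof -
  let ?E = "exp (s * (\<Sum>y\<in>{1..<N}. Digamma (base_weight y + 1/2 + s) - Digamma (base_weight y - s)))"
  let ?F = "\<lambda>p. \<Sum>i\<in>{1..<N}. urn_sum s N i n p"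
  let ?c = "\<lambda>j. if j = N then 1 + base_weight (N - 1) powr s else 1"
  \<comment> \<open>The lower bound of \<open>urn_sum_ge\<close> for an edge crossed at least \<open>n / N\<close> times.\<close>
  define c where "c = 1/3 * (n / (2 * N)) powr s"
  have c: "c > 0" using N n by (simp add: c_def)
  have \<beta>: "\<beta> \<ge> 0" using s(4)[of 0] base_weight_pos[of 0] N by simp
  have sb: "s < base_weight y" if "y < N" for y using s(3)[OF that] base_weight_pos[of y] by linarith
  have mart_nonneg: "urn_mart s {i..<j} n p \<ge> 0" if "p \<in> paths n" "1 \<le> i" "j \<le> N" for i j p
    using that sb s by (intro less_imp_le[OF urn_mart_pos]) auto
  have sum_nonneg': "urn_sum s N i n p \<ge> 0" if "p \<in> paths n" "1 \<le> i" for i p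
    unfolding urn_sum_def using that mart_nonneg by (intro sum_nonneg mult_nonneg_nonneg) auto
  have "prob {\<omega>\<in>space M. \<forall>k\<le>n. X k \<omega> \<noteq> N} \<le> expect n ?F / c"
  proof (rule markov_paths)
    fix p assume p: "p \<in> paths n"
    show "?F p \<ge> 0" using sum_nonneg'[OF p] by (intro sum_nonneg) auto
    assume nohit: "\<forall>k\<le>n. p k \<noteq> N"
    have lt: "p k < N" if "k \<le> n" for k using paths_less[OF p] nohit N that by simp
    have "\<exists>i\<in>{1..<N}. real (traversals p n (i - 1)) \<ge> n / N"
    proof (rule ccontr)
      assume "\<not> ?thesis"
      hence *: "real (traversals p n (i - 1)) \<le> n / N" if "i \<in> {1..<N}" for i using that by force
      have "real n = (\<Sum>i\<in>{1..<N}. real (traversals p n (i - 1)))"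
        using sum_traversals[OF p lt] by (simp flip: of_nat_sum)
      also have "\<dots> \<le> (\<Sum>i\<in>{1..<N}. n / N)" by (intro sum_mono *)
      also have "\<dots> < n" using N n by (simp add: field_simps of_nat_diff)
      finally show False by simp
    qed
    then obtain i where i: "i \<in> {1..<N}" "real (traversals p n (i - 1)) \<ge> n / N" by blast
    have "c \<le> 1/3 * (traversals p n (i - 1) / 2) powr s"
      unfolding c_def using i(2) s by (intro mult_left_mono powr_mono2) (auto simp: field_simps)
    also have "\<dots> \<le> urn_sum s N i n p" using i(1) by (intro urn_sum_ge p lt s sb) auto
    also have "\<dots> \<le> ?F p" using i(1) sum_nonneg'[OF p] by (intro member_le_sum) auto
    finally show "c \<le> ?F p" .
  next
    fix p q :: "nat \<Rightarrow> nat" assume "\<And>i. i \<le> n \<Longrightarrow> p i = q i"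
    thus "(\<forall>k\<le>n. p k \<noteq> N) = (\<forall>k\<le>n. q k \<noteq> N)" by metis
  qed (use c in measurable)
  also have "expect n ?F \<le> 8 * N\<^sup>2 * (\<beta> + 2)\<^sup>2 * ?E"
  proof -
    have "expect n ?F = (\<Sum>i\<in>{1..<N}. \<Sum>j\<in>{i..N}. ?c j * expect n (urn_mart s {i..<j} n))"
      by (simp add: expect_sum urn_sum_def expect_cmult cong: if_cong)
    also have "\<dots> \<le> (\<Sum>i\<in>{1..<N}. \<Sum>j\<in>{i..N}. (\<beta> + 2) * (8 * (\<beta> + 2) * ?E))"
    proof (intro sum_mono mult_mono)
      fix i j assume ij: "i \<in> {1..<N}" "j \<in> {i..N}"
      have "expect n (urn_mart s {i..<j} n) = urn_mart s {i..<j} 0 (\<lambda>_. 0)"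
        using ij s sb by (intro urn_mart_expect) auto
      also have "\<dots> \<le> 8 * (\<beta> + 2) * ?E" using ij by (intro urn_mart_start_up s) auto
      finally show "expect n (urn_mart s {i..<j} n) \<le> 8 * (\<beta> + 2) * ?E" .
      show "0 \<le> expect n (urn_mart s {i..<j} n)"
        unfolding expect_def using ij mart_nonneg by (intro sum_nonneg mult_nonneg_nonneg) auto
      have "base_weight (N - 1) powr s \<le> 1 + base_weight (N - 1)" using s base_weight_pos by (intro powr_le_1_plus) auto
      moreover have "base_weight (N - 1) \<le> \<beta>" using s(4) N by simp
      ultimately show "?c j \<le> \<beta> + 2" using \<beta> by simp
    qed (use \<beta> in auto)
    also have "\<dots> \<le> (\<Sum>i\<in>{1..<N}. N * ((\<beta> + 2) * (8 * (\<beta> + 2) * ?E)))"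
      using \<beta> by (intro sum_mono) (auto intro!: mult_right_mono)
    also have "\<dots> \<le> N * (N * ((\<beta> + 2) * (8 * (\<beta> + 2) * ?E)))"
      using \<beta> N by (auto intro!: mult_right_mono)
    finally show ?thesis by (simp add: power2_eq_square mult_ac)
  qed
  hence "expect n ?F / c \<le> (8 * N\<^sup>2 * (\<beta> + 2)\<^sup>2 * ?E) / c"
    using c by (intro divide_right_mono) auto
  also have "\<dots> = 24 * N\<^sup>2 * (\<beta> + 2)\<^sup>2 * ?E * (1 / (n / (2 * N)) powr s)"
    by (simp add: c_def)
  also have "1 / (n / (2 * N)) powr s = (2 * N / n) powr s"
    using N n by (simp add: powr_divide powr_mult)
  finally show ?thesis by (simp add: mult_ac)
qed

end

section \<open>Growth of the Digamma differences\<close>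

text \<open>Digamma is concave, so its slope over \<open>[x, x + h]\<close> is at least the slope over \<open>[x, x + 1]\<close>, which is
  \<open>1 / x\<close> by the functional equation.\<close>

lemma Digamma_step_ge:
  assumes "x > 0" "0 \<le> h" "h \<le> (1::real)"
  shows "Digamma (x + h) - Digamma x \<ge> h / x"
proof (cases "h = 0 \<or> h = 1")
  case True
  thus ?thesis using assms Digamma_plus1[of x] by (auto simp: field_simps)
next
  case False
  have d: "(Digamma has_real_derivative Polygamma 1 z) (at z)" if "z \<ge> x" for z
  proof -
    have "z \<notin> \<int>\<^sub>\<le>\<^sub>0" using that assms by (auto elim!: nonpos_Ints_cases)
    thus ?thesis using has_field_derivative_Polygamma[of z 0] by simp
  qed
  obtain z where z: "x < z" "z < x + h" "Digamma (x + h) - Digamma x = h * Polygamma 1 z"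
    using MVT2[of x "x + h" Digamma "Polygamma 1"] d False assms by auto
  obtain w where w: "x + h < w" "w < x + 1" "Digamma (x + 1) - Digamma (x + h) = (1 - h) * Polygamma 1 w"
    using MVT2[of "x + h" "x + 1" Digamma "Polygamma 1"] d False assms by auto
  have "Polygamma 1 w \<le> Polygamma 1 z"
    using Polygamma_real_strict_antimono[of z w 1] z w assms by simp
  hence "(1 - h) * Polygamma 1 w \<le> (1 - h) * Polygamma 1 z" using assms by (intro mult_left_mono) auto
  hence "Digamma (x + 1) - Digamma x \<le> Polygamma 1 z" using z(3) w(3) by (simp add: algebra_simps)
  moreover have "Digamma (x + 1) - Digamma x = 1 / x" using assms Digamma_plus1[of x] by simp
  ultimately show ?thesis using z(3) assms mult_left_mono[of "1/x" "Polygamma 1 z" h] by simp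
qed

lemma Digamma_step_le:
  assumes "x > 1" "0 \<le> (h::real)"
  shows "Digamma (x + h) - Digamma x \<le> h / (x - 1)"
proof (cases "h = 0")
  case False
  have d: "(Digamma has_real_derivative Polygamma 1 z) (at z)" if "z \<ge> x - 1" for z
  proof -
    have "z \<notin> \<int>\<^sub>\<le>\<^sub>0" using that assms by (auto elim!: nonpos_Ints_cases)
    thus ?thesis using has_field_derivative_Polygamma[of z 0] by simp
  qed
  obtain z where z: "x < z" "z < x + h" "Digamma (x + h) - Digamma x = h * Polygamma 1 z"
    using MVT2[of x "x + h" Digamma "Polygamma 1"] d False assms by auto
  obtain w where w: "x - 1 < w" "w < x" "Digamma x - Digamma (x - 1) = Polygamma 1 w"
    using MVT2[of "x - 1" "x" Digamma "Polygamma 1"] d assms by auto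
  have "Polygamma 1 z \<le> Polygamma 1 w"
    using Polygamma_real_strict_antimono[of w z 1] z w assms by simp
  moreover have "Digamma x - Digamma (x - 1) = 1 / (x - 1)" using assms Digamma_plus1[of "x - 1"] by simp
  ultimately show ?thesis using z(3) w(3) assms mult_left_mono[of "Polygamma 1 z" "1/(x-1)" h] by simp
qed simp

definition scaled_weight :: "real \<Rightarrow> real \<Rightarrow> nat \<Rightarrow> real" where
  "scaled_weight \<alpha> \<Delta> y = power_weights \<alpha> y / (2 * \<Delta>)"

text \<open>The asymptotic potential of \<open>y\<close>, which is the logarithm of the time at which level \<open>y\<close> is expected to
  be reached.\<close>

definition level :: "real \<Rightarrow> real \<Rightarrow> nat \<Rightarrow> real" where
  "level \<alpha> \<Delta> y = real y powr (1 - \<alpha>) / K \<alpha> \<Delta>"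

lemma K_pos: "\<alpha> < 1 \<Longrightarrow> \<Delta> > 0 \<Longrightarrow> K \<alpha> \<Delta> > 0"
  using Digamma_real_strict_mono[of "1 / (2 * \<Delta>)" "1 / (2 * \<Delta>) + 1/2"] by (simp add: K_def)

lemma powr_diff_mvt:
  fixes y :: nat
  assumes "\<alpha> < 1" "y \<ge> 1"
  obtains \<xi> where "real y < \<xi>" "\<xi> < real y + 1"
    "real (Suc y) powr (1 - \<alpha>) - real y powr (1 - \<alpha>) = (1 - \<alpha>) * \<xi> powr (- \<alpha>)"
proof -
  have "\<exists>z>real y. z < real y + 1 \<and> (real y + 1) powr (1 - \<alpha>) - real y powr (1 - \<alpha>) = (real y + 1 - real y) * ((1 - \<alpha>) * z powr (- \<alpha>))"
    using assms by (intro MVT2) (auto intro!: derivative_eq_intros)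
  thus ?thesis using that by (auto simp: add_ac)
qed

text \<open>The increment of \<open>level\<close> agrees up to a factor \<open>1 \<plusminus> \<epsilon>\<close> with the potential of the edge, uniformly in the
  tilt \<open>s\<close>. The tilt has to be small both absolutely and relative to the weight, since Digamma has a
  pole at \<open>0\<close>. Comparing increments rather than sums makes the sums telescope.\<close>

definition level_step_approx :: "real \<Rightarrow> real \<Rightarrow> real \<Rightarrow> real \<Rightarrow> nat \<Rightarrow> bool" where
  "level_step_approx \<alpha> \<Delta> \<epsilon> \<eta> y \<longleftrightarrow> (\<forall>s. 0 < s \<longrightarrow> s \<le> \<eta> \<longrightarrow> s \<le> \<eta> * scaled_weight \<alpha> \<Delta> y \<longrightarrow>
    (1 - \<epsilon>) * (level \<alpha> \<Delta> (Suc y) - level \<alpha> \<Delta> y)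
      \<le> Digamma (scaled_weight \<alpha> \<Delta> y + 1/2 - s) - Digamma (scaled_weight \<alpha> \<Delta> y + s) \<and>
    Digamma (scaled_weight \<alpha> \<Delta> y + 1/2 + s) - Digamma (scaled_weight \<alpha> \<Delta> y - s)
      \<le> (1 + \<epsilon>) * (level \<alpha> \<Delta> (Suc y) - level \<alpha> \<Delta> y))"

text \<open>The weights tend to infinity and \<open>\<Psi>(b + 1/2) - \<Psi>(b)\<close> is asymptotic to \<open>1 / (2 b)\<close>.\<close>

lemma level_step_approx_pos:
  fixes \<epsilon> :: real
  assumes "0 < \<alpha>" "\<alpha> < 1" "\<Delta> > 0" "0 < \<epsilon>" "\<epsilon> < 1"
  shows "\<exists>\<eta>>0. \<forall>\<^sub>F y in sequentially. level_step_approx \<alpha> \<Delta> \<epsilon> \<eta> y"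
proof (intro exI conjI)
  define \<eta> where "\<eta> = \<epsilon> / 8"
  show "\<eta> > 0" using assms by (simp add: \<eta>_def)
  have "((\<lambda>y::nat. (real y powr \<alpha> / (2 * \<Delta>) - \<eta> - 1) * (\<Delta> * (real y + 1) powr (- \<alpha>))) \<longlongrightarrow> 1/2) sequentially"
    using assms by real_asymp
  hence 1: "\<forall>\<^sub>F y::nat in sequentially. (real y powr \<alpha> / (2 * \<Delta>) - \<eta> - 1) * (\<Delta> * (real y + 1) powr (- \<alpha>)) > (1/2 + 2 * \<eta>) / (1 + \<epsilon>)"
    using assms by (intro order_tendstoD(1)) (auto simp: \<eta>_def field_simps)
  have "filterlim (\<lambda>y::nat. real y powr \<alpha> / (2 * \<Delta>)) at_top sequentially"
    using assms by real_asymp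
  hence 2: "\<forall>\<^sub>F y::nat in sequentially. real y powr \<alpha> / (2 * \<Delta>) \<ge> 2"
    by (simp add: filterlim_at_top)
  show "\<forall>\<^sub>F y in sequentially. level_step_approx \<alpha> \<Delta> \<epsilon> \<eta> y"
    using 1 2 eventually_ge_at_top[of 1]
  proof eventually_elim
    case (elim y)
    show ?case
      unfolding level_step_approx_def
    proof (intro allI impI)
      fix s assume s0: "0 < s" "s \<le> \<eta>" "s \<le> \<eta> * scaled_weight \<alpha> \<Delta> y"
      define b where "b = real y powr \<alpha> / (2 * \<Delta>)"
      have w: "scaled_weight \<alpha> \<Delta> y = b" using elim by (simp add: scaled_weight_def power_weights_def b_def)
      have b: "b \<ge> 2" using elim by (simp add: b_def)
      obtain \<xi> where \<xi>: "real y < \<xi>" "\<xi> < real y + 1"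
        "real (Suc y) powr (1 - \<alpha>) - real y powr (1 - \<alpha>) = (1 - \<alpha>) * \<xi> powr (- \<alpha>)"
        using powr_diff_mvt[of \<alpha> y] assms elim by blast
      have "level \<alpha> \<Delta> (Suc y) - level \<alpha> \<Delta> y = (1 - \<alpha>) * \<xi> powr (- \<alpha>) / K \<alpha> \<Delta>"
        unfolding level_def \<xi>(3)[symmetric] by (simp add: diff_divide_distrib)
      also have "\<dots> = \<Delta> * \<xi> powr (- \<alpha>)" using assms by (simp add: K_def)
      finally have L: "level \<alpha> \<Delta> (Suc y) - level \<alpha> \<Delta> y = \<Delta> * \<xi> powr (- \<alpha>)" .
      have "\<Delta> * \<xi> powr (- \<alpha>) \<le> \<Delta> * real y powr (- \<alpha>)" using \<xi> assms elim
        by (intro mult_left_mono powr_mono2') auto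
      also have "\<dots> = 1 / (2 * b)" using assms elim by (simp add: b_def powr_minus field_simps)
      finally have L1: "\<Delta> * \<xi> powr (- \<alpha>) \<le> 1 / (2 * b)" .
      have L2: "\<Delta> * (real y + 1) powr (- \<alpha>) \<le> \<Delta> * \<xi> powr (- \<alpha>)" using \<xi> assms elim
        by (intro mult_left_mono powr_mono2') auto
      have s: "0 < s" "s \<le> \<epsilon> / 8" using s0 by (auto simp: \<eta>_def)
      have "(1 - \<epsilon>) * (\<Delta> * \<xi> powr (- \<alpha>)) \<le> (1 - \<epsilon>) * (1 / (2 * b))"
        using assms by (intro mult_left_mono L1) auto
      also have "\<dots> \<le> (1/2 - 2 * s) / (b + s)"
      proof -
        have "(1 - \<epsilon>) * (b + s) \<le> (1 - \<epsilon>) * (b + \<epsilon> / 8)"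
          using assms s by (intro mult_left_mono) auto
        also have "\<dots> \<le> (1 - \<epsilon>) * b + \<epsilon> / 2 * b"
        proof -
          have "(1 - \<epsilon>) * (\<epsilon> / 8) \<le> 1 * (\<epsilon> / 2 * b)" using assms b by (intro mult_mono) auto
          thus ?thesis by (simp add: algebra_simps)
        qed
        also have "\<dots> = (1 - 4 * (\<epsilon> / 8)) * b" by (simp add: algebra_simps)
        also have "\<dots> \<le> (1 - 4 * s) * b" using s b by (intro mult_right_mono) auto
        finally show ?thesis using b s by (simp add: field_simps)
      qed
      also have "\<dots> \<le> Digamma (b + s + (1/2 - 2 * s)) - Digamma (b + s)"
        using b s assms by (intro Digamma_step_ge) auto
      finally have A: "(1 - \<epsilon>) * (\<Delta> * \<xi> powr (- \<alpha>)) \<le> Digamma (b + 1/2 - s) - Digamma (b + s)"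
        by (simp add: algebra_simps)
      have "Digamma (b - s + (1/2 + 2 * s)) - Digamma (b - s) \<le> (1/2 + 2 * s) / (b - s - 1)"
        using b s assms by (intro Digamma_step_le) auto
      also have "\<dots> \<le> (1/2 + 2 * \<eta>) / (b - \<eta> - 1)"
        using b s assms by (intro frac_le) (auto simp: \<eta>_def)
      also have "\<dots> \<le> (1 + \<epsilon>) * (\<Delta> * (real y + 1) powr (- \<alpha>))"
      proof -
        have "b - \<eta> - 1 > 0" using b assms by (simp add: \<eta>_def)
        moreover have "(1/2 + 2 * \<eta>) / (1 + \<epsilon>) < (b - \<eta> - 1) * (\<Delta> * (real y + 1) powr (- \<alpha>))"
          using elim by (simp add: b_def)
        ultimately show ?thesis using assms by (simp add: pos_divide_le_eq pos_divide_less_eq mult_ac)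
      qed
      also have "\<dots> \<le> (1 + \<epsilon>) * (\<Delta> * \<xi> powr (- \<alpha>))" using assms by (intro mult_left_mono L2) auto
      finally have B: "Digamma (b + 1/2 + s) - Digamma (b - s) \<le> (1 + \<epsilon>) * (\<Delta> * \<xi> powr (- \<alpha>))"
        by (simp add: algebra_simps)
      from A B show "(1 - \<epsilon>) * (level \<alpha> \<Delta> (Suc y) - level \<alpha> \<Delta> y)
        \<le> Digamma (scaled_weight \<alpha> \<Delta> y + 1/2 - s) - Digamma (scaled_weight \<alpha> \<Delta> y + s) \<and>
      Digamma (scaled_weight \<alpha> \<Delta> y + 1/2 + s) - Digamma (scaled_weight \<alpha> \<Delta> y - s)
        \<le> (1 + \<epsilon>) * (level \<alpha> \<Delta> (Suc y) - level \<alpha> \<Delta> y)"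
        unfolding w L by simp
    qed
  qed
qed

text \<open>The weights tend to \<open>0\<close> and \<open>\<Psi>(b + 1/2) - \<Psi>(b)\<close> is dominated by the pole, that is by \<open>1 / b\<close>. This is
  where the factor \<open>2\<close> between the two formulas for \<open>K\<close> comes from.\<close>

lemma level_step_approx_neg:
  fixes \<epsilon> :: real
  assumes "\<alpha> < 0" "\<Delta> > 0" "0 < \<epsilon>" "\<epsilon> < 1"
  shows "\<exists>\<eta>>0. \<forall>\<^sub>F y in sequentially. level_step_approx \<alpha> \<Delta> \<epsilon> \<eta> y"
proof (intro exI conjI)
  define \<eta> where "\<eta> = \<epsilon> / 8"
  \<comment> \<open>Bounds what remains of the Digamma difference after the pole at \<open>0\<close> has been split off.\<close>
  define C where "C = Digamma (3::real) - Digamma (1/4)"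
  show "\<eta> > 0" using assms by (simp add: \<eta>_def)
  have "((\<lambda>y::nat. (2 * \<Delta> * real y powr (-\<alpha>) / (1 + \<eta>) - C) / (2 * \<Delta> * (real y + 1) powr (- \<alpha>))) \<longlongrightarrow> \<Delta> * (inverse (1 + \<eta>) * inverse \<Delta>)) sequentially"
    using assms \<open>\<eta> > 0\<close> by real_asymp
  hence 1: "\<forall>\<^sub>F y::nat in sequentially. (2 * \<Delta> * real y powr (-\<alpha>) / (1 + \<eta>) - C) / (2 * \<Delta> * (real y + 1) powr (- \<alpha>)) > 1 - \<epsilon>"
  proof (rule order_tendstoD(1))
    have "(1 - \<epsilon>) * (1 + \<eta>) < 1"
      using assms by (simp add: \<eta>_def algebra_simps add_pos_pos)
    hence "1 - \<epsilon> < 1 / (1 + \<eta>)" using \<open>\<eta> > 0\<close> by (simp add: pos_less_divide_eq)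
    also have "\<dots> = \<Delta> * (inverse (1 + \<eta>) * inverse \<Delta>)" using assms by (simp add: inverse_eq_divide)
    finally show "1 - \<epsilon> < \<Delta> * (inverse (1 + \<eta>) * inverse \<Delta>)" .
  qed
  have "filterlim (\<lambda>y::nat. real y powr \<alpha> / (2 * \<Delta>)) (nhds 0) sequentially"
    using assms by real_asymp
  hence 2: "\<forall>\<^sub>F y::nat in sequentially. real y powr \<alpha> / (2 * \<Delta>) < 1"
    by (intro order_tendstoD(2)) auto
  show "\<forall>\<^sub>F y in sequentially. level_step_approx \<alpha> \<Delta> \<epsilon> \<eta> y"
    using 1 2 eventually_ge_at_top[of 1]
  proof eventually_elim
    case (elim y)
    show ?case
      unfolding level_step_approx_def
    proof (intro allI impI)
      fix s assume s0: "0 < s" "s \<le> \<eta>" "s \<le> \<eta> * scaled_weight \<alpha> \<Delta> y"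
      define b where "b = real y powr \<alpha> / (2 * \<Delta>)"
      have w: "scaled_weight \<alpha> \<Delta> y = b" using elim by (simp add: scaled_weight_def power_weights_def b_def)
      have b: "b > 0" "b < 1" using elim assms by (auto simp: b_def)
      have bi: "1 / b = 2 * \<Delta> * real y powr (- \<alpha>)" using assms elim by (simp add: b_def powr_minus field_simps)
      obtain \<xi> where \<xi>: "real y < \<xi>" "\<xi> < real y + 1"
        "real (Suc y) powr (1 - \<alpha>) - real y powr (1 - \<alpha>) = (1 - \<alpha>) * \<xi> powr (- \<alpha>)"
        using powr_diff_mvt[of \<alpha> y] assms elim by auto
      have "level \<alpha> \<Delta> (Suc y) - level \<alpha> \<Delta> y = (1 - \<alpha>) * \<xi> powr (- \<alpha>) / K \<alpha> \<Delta>"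
        unfolding level_def \<xi>(3)[symmetric] by (simp add: diff_divide_distrib)
      also have "\<dots> = 2 * \<Delta> * \<xi> powr (- \<alpha>)" using assms by (simp add: K_def)
      finally have L: "level \<alpha> \<Delta> (Suc y) - level \<alpha> \<Delta> y = 2 * \<Delta> * \<xi> powr (- \<alpha>)" .
      have L1: "2 * \<Delta> * \<xi> powr (- \<alpha>) \<le> 2 * \<Delta> * (real y + 1) powr (- \<alpha>)" using \<xi> assms elim
        by (intro mult_left_mono powr_mono2) auto
      have "2 * \<Delta> * real y powr (- \<alpha>) \<le> 2 * \<Delta> * \<xi> powr (- \<alpha>)" using \<xi> assms elim
        by (intro mult_left_mono powr_mono2) auto
      hence L2: "1 / b \<le> 2 * \<Delta> * \<xi> powr (- \<alpha>)" using bi by simp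
      have s: "0 < s" "s \<le> 1/8" "s \<le> \<eta> * b" "\<eta> * b < b" using s0 assms b by (auto simp: \<eta>_def w)
      have "(1 - \<epsilon>) * (2 * \<Delta> * \<xi> powr (- \<alpha>)) \<le> (1 - \<epsilon>) * (2 * \<Delta> * (real y + 1) powr (- \<alpha>))"
        using assms by (intro mult_left_mono L1) auto
      also have "\<dots> \<le> 2 * \<Delta> * real y powr (-\<alpha>) / (1 + \<eta>) - C"
        using elim(1) assms by (simp add: pos_less_divide_eq less_imp_le)
      also have "\<dots> = 1 / (b + \<eta> * b) - C" unfolding bi[symmetric] by (simp add: algebra_simps)
      also have "\<dots> \<le> 1 / (b + s) - C" using s b by (intro diff_right_mono divide_left_mono) auto
      also have "\<dots> \<le> Digamma (b + 1/2 - s) - Digamma (b + s)"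
      proof -
        have "Digamma (b + s + 1) = Digamma (b + s) + 1 / (b + s)" using b s by (intro Digamma_plus1) auto
        moreover have "Digamma (b + s + 1) \<le> Digamma 3" using b s by (intro Digamma_real_mono) auto
        moreover have "Digamma (1/4) \<le> Digamma (b + 1/2 - s)" using b s by (intro Digamma_real_mono) auto
        ultimately show ?thesis by (simp add: C_def)
      qed
      finally have A: "(1 - \<epsilon>) * (2 * \<Delta> * \<xi> powr (- \<alpha>)) \<le> Digamma (b + 1/2 - s) - Digamma (b + s)" .
      have "Digamma (b - s + 1) = Digamma (b - s) + 1 / (b - s)" using b s by (intro Digamma_plus1) auto
      moreover have "Digamma (b + 1/2 + s) \<le> Digamma (b - s + 1)" using b s by (intro Digamma_real_mono) auto
      ultimately have "Digamma (b + 1/2 + s) - Digamma (b - s) \<le> 1 / (b - s)" by simp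
      also have "\<dots> \<le> 1 / (b - \<eta> * b)" using s(3,4) by (intro frac_le) auto
      also have "\<dots> = (1 / (1 - \<eta>)) * (1 / b)" by (simp add: algebra_simps)
      also have "\<dots> \<le> (1 + \<epsilon>) * (1 / b)"
      proof -
        have "\<epsilon> * \<epsilon> \<le> \<epsilon> * 1" using assms by (intro mult_left_mono) auto
        hence "1 / (1 - \<eta>) \<le> 1 + \<epsilon>" using assms by (simp add: \<eta>_def field_simps)
        thus ?thesis using b by (intro mult_right_mono) auto
      qed
      also have "\<dots> \<le> (1 + \<epsilon>) * (2 * \<Delta> * \<xi> powr (- \<alpha>))" using assms by (intro mult_left_mono L2) auto
      finally show "(1 - \<epsilon>) * (level \<alpha> \<Delta> (Suc y) - level \<alpha> \<Delta> y)
        \<le> Digamma (scaled_weight \<alpha> \<Delta> y + 1/2 - s) - Digamma (scaled_weight \<alpha> \<Delta> y + s) \<and>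
      Digamma (scaled_weight \<alpha> \<Delta> y + 1/2 + s) - Digamma (scaled_weight \<alpha> \<Delta> y - s)
        \<le> (1 + \<epsilon>) * (level \<alpha> \<Delta> (Suc y) - level \<alpha> \<Delta> y)"
        unfolding w L using A by simp
    qed
  qed
qed

text \<open>The weights are constant and \<open>K\<close> is the reciprocal of the Digamma difference, so for \<open>s = 0\<close> equality
  holds; the rest is continuity in \<open>s\<close>.\<close>

lemma level_step_approx_zero:
  fixes \<epsilon> :: real
  assumes "\<Delta> > 0" "0 < \<epsilon>" "\<epsilon> < 1"
  shows "\<exists>\<eta>>0. \<forall>\<^sub>F y in sequentially. level_step_approx 0 \<Delta> \<epsilon> \<eta> y"
proof -
  define b where "b = 1 / (2 * \<Delta>)"
  have b: "b > 0" using assms by (simp add: b_def)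
  define D where "D = (\<lambda>s. Digamma (b + 1/2 + s) - Digamma (b - s))"
  have D: "D 0 > 0" using Digamma_real_strict_mono[of b "b + 1/2"] b by (simp add: D_def)
  have "isCont D 0" unfolding D_def using b
    by (intro continuous_intros) (auto elim!: nonpos_Ints_cases)
  hence lim: "(D \<longlongrightarrow> D 0) (nhds 0)" by (simp add: continuous_at tendsto_nhds_iff)
  have "(1 - \<epsilon>) * D 0 < D 0" "D 0 < (1 + \<epsilon>) * D 0" using D assms by auto
  hence "\<forall>\<^sub>F s in nhds 0. (1 - \<epsilon>) * D 0 < D s \<and> D s < (1 + \<epsilon>) * D 0"
    using order_tendstoD[OF lim] by (intro eventually_conj) auto
  then obtain e where e: "e > 0" "\<And>s. dist s 0 < e \<Longrightarrow> (1 - \<epsilon>) * D 0 < D s \<and> D s < (1 + \<epsilon>) * D 0"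
    unfolding eventually_nhds_metric by blast
  have w: "scaled_weight 0 \<Delta> y = b" for y by (simp add: scaled_weight_def power_weights_def b_def)
  have L: "level 0 \<Delta> (Suc y) - level 0 \<Delta> y = D 0" for y
    using assms by (simp add: level_def K_def D_def b_def field_simps)
  show ?thesis
    unfolding level_step_approx_def
  proof (intro exI[of _ "e / 2"] conjI always_eventually allI impI)
    fix s assume s: "0 < s" "s \<le> e / 2"
    show "(1 - \<epsilon>) * (level 0 \<Delta> (Suc y) - level 0 \<Delta> y)
        \<le> Digamma (scaled_weight 0 \<Delta> y + 1/2 - s) - Digamma (scaled_weight 0 \<Delta> y + s)" for y
      using e(2)[of "- s"] s e(1) unfolding w L by (simp add: D_def)
    show "Digamma (scaled_weight 0 \<Delta> y + 1/2 + s) - Digamma (scaled_weight 0 \<Delta> y - s)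
        \<le> (1 + \<epsilon>) * (level 0 \<Delta> (Suc y) - level 0 \<Delta> y)" for y
      using e(2)[of s] s e(1) unfolding w L by (simp add: D_def)
  qed (use e in auto)
qed

lemma level_step_bounds:
  fixes \<epsilon> :: real
  assumes "\<alpha> < 1" "\<Delta> > 0" "0 < \<epsilon>" "\<epsilon> < 1"
  obtains \<eta> Y where "\<eta> > 0" "Y \<ge> 1"
    "\<And>y s. y \<ge> Y \<Longrightarrow> 0 < s \<Longrightarrow> s \<le> \<eta> \<Longrightarrow> s \<le> \<eta> * scaled_weight \<alpha> \<Delta> y \<Longrightarrow>
    (1 - \<epsilon>) * (level \<alpha> \<Delta> (Suc y) - level \<alpha> \<Delta> y)
        \<le> Digamma (scaled_weight \<alpha> \<Delta> y + 1/2 - s) - Digamma (scaled_weight \<alpha> \<Delta> y + s)"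
    "\<And>y s. y \<ge> Y \<Longrightarrow> 0 < s \<Longrightarrow> s \<le> \<eta> \<Longrightarrow> s \<le> \<eta> * scaled_weight \<alpha> \<Delta> y \<Longrightarrow>
    Digamma (scaled_weight \<alpha> \<Delta> y + 1/2 + s) - Digamma (scaled_weight \<alpha> \<Delta> y - s)
        \<le> (1 + \<epsilon>) * (level \<alpha> \<Delta> (Suc y) - level \<alpha> \<Delta> y)"
proof -
  consider "\<alpha> < 0" | "\<alpha> = 0" | "0 < \<alpha>" by linarith
  hence "\<exists>\<eta>>0. \<forall>\<^sub>F y in sequentially. level_step_approx \<alpha> \<Delta> \<epsilon> \<eta> y"
  proof cases
    case 1 thus ?thesis using assms by (intro level_step_approx_neg) auto
  next
    case 2 show ?thesis unfolding 2 using assms by (intro level_step_approx_zero) auto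
  next
    case 3 thus ?thesis using assms by (intro level_step_approx_pos) auto
  qed
  then obtain \<eta> where \<eta>: "\<eta> > 0" "\<forall>\<^sub>F y in sequentially. level_step_approx \<alpha> \<Delta> \<epsilon> \<eta> y" by blast
  then obtain Y where Y: "\<And>y. y \<ge> Y \<Longrightarrow> level_step_approx \<alpha> \<Delta> \<epsilon> \<eta> y" unfolding eventually_sequentially by blast
  show ?thesis by (rule that[of \<eta> "max 1 Y"]) (use \<eta> Y in \<open>auto simp: level_step_approx_def\<close>)
qed

lemma scaled_weight_ge:
  assumes "\<Delta> > 0" "y < N"
  shows "scaled_weight \<alpha> \<Delta> y \<ge> real N powr min \<alpha> 0 * (1 / (2 * \<Delta>))"
proof -
  have "real N powr min \<alpha> 0 \<le> power_weights \<alpha> y"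
  proof (cases "y = 0")
    case True
    have "real N powr min \<alpha> 0 \<le> 1 powr min \<alpha> 0" using assms by (intro powr_mono2') auto
    thus ?thesis using True by (simp add: power_weights_def)
  next
    case False
    have "real N powr min \<alpha> 0 \<le> real y powr min \<alpha> 0" using assms False by (intro powr_mono2') auto
    also have "\<dots> \<le> real y powr \<alpha>" using False by (intro powr_mono) auto
    finally show ?thesis using False by (simp add: power_weights_def)
  qed
  thus ?thesis using assms by (simp add: scaled_weight_def divide_right_mono)
qed

lemma scaled_weight_le:
  fixes y N :: nat
  assumes "\<Delta> > 0" "y < N" "\<alpha> < 1"
  shows "scaled_weight \<alpha> \<Delta> y \<le> N / (2 * \<Delta>)"
proof -
  have "power_weights \<alpha> y \<le> N"
  proof (cases "y = 0")
    case False
    have "real y powr \<alpha> \<le> real y powr 1" using False assms by (intro powr_mono) auto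
    also have "\<dots> \<le> N" using assms by simp
    finally show ?thesis using False by (simp add: power_weights_def)
  qed (use assms in \<open>auto simp: power_weights_def\<close>)
  thus ?thesis using assms by (simp add: scaled_weight_def divide_right_mono)
qed

lemma level_nonneg: "\<alpha> < 1 \<Longrightarrow> \<Delta> > 0 \<Longrightarrow> level \<alpha> \<Delta> x \<ge> 0"
  unfolding level_def using K_pos[of \<alpha> \<Delta>] by auto

lemma sum_level:
  "i \<le> j \<Longrightarrow> (\<Sum>y\<in>{i..<j}. c * (level \<alpha> \<Delta> (Suc y) - level \<alpha> \<Delta> y)) = c * (level \<alpha> \<Delta> j - level \<alpha> \<Delta> i)"
  by (subst sum_distrib_left [symmetric], subst sum_Suc_diff') auto

section \<open>Hitting times for power weights\<close>

locale power_lerrw = lerrw_pos M "power_weights \<alpha>" \<Delta> X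
  for M :: "'a measure" and \<alpha> \<Delta> :: real and X :: "nat \<Rightarrow> 'a \<Rightarrow> nat" +
  assumes exponent: "\<alpha> < 1"
begin

lemma base_weight_eq: "base_weight y = scaled_weight \<alpha> \<Delta> y"
  by (simp add: base_weight_def scaled_weight_def)

text \<open>The exponent used for level \<open>N\<close>. The power of \<open>N\<close> keeps it below a fixed multiple of each initial
  weight \<open>base_weight y\<close> with \<open>y < N\<close>; these weights shrink when \<open>\<alpha> < 0\<close>.\<close>

definition tilt :: "real \<Rightarrow> nat \<Rightarrow> real" where
  "tilt \<eta> N = min \<eta> (1/4) * min 1 (1 / (2 * \<Delta>)) * real N powr min \<alpha> 0"

lemma tilt_bounds:
  assumes "\<eta> > 0" "N \<ge> 1"
  shows "tilt \<eta> N > 0" "tilt \<eta> N \<le> 1/4" "tilt \<eta> N \<le> \<eta>"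
    and "y < N \<Longrightarrow> tilt \<eta> N \<le> \<eta> * base_weight y" "y < N \<Longrightarrow> tilt \<eta> N \<le> base_weight y / 4"
proof -
  have N: "real N powr min \<alpha> 0 \<le> 1"
    using powr_mono2'[of "min \<alpha> 0" 1 "real N"] assms by simp
  have Np: "real N powr min \<alpha> 0 > 0" using assms by simp
  let ?m = "min \<eta> (1/4)" and ?d = "min 1 (1 / (2 * \<Delta>))"
  have m: "?m > 0" "?d > 0" "?d \<le> 1" using assms reinforcement_pos by auto
  show "tilt \<eta> N > 0" unfolding tilt_def using m Np by (intro mult_pos_pos)
  have "?d * real N powr min \<alpha> 0 \<le> 1" using m N Np by (intro mult_le_one) auto
  hence *: "tilt \<eta> N \<le> ?m" unfolding tilt_def mult.assoc
    using m mult_left_mono[of "?d * real N powr min \<alpha> 0" 1 ?m] by simp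
  thus "tilt \<eta> N \<le> 1/4" "tilt \<eta> N \<le> \<eta>" by auto
  assume y: "y < N"
  have "?d * real N powr min \<alpha> 0 \<le> real N powr min \<alpha> 0 * (1 / (2 * \<Delta>))"
    using Np by (subst mult.commute) (intro mult_left_mono, auto)
  also have "\<dots> \<le> base_weight y" unfolding base_weight_eq using reinforcement_pos y by (intro scaled_weight_ge)
  finally have "tilt \<eta> N \<le> ?m * base_weight y" unfolding tilt_def mult.assoc
    using m by (intro mult_left_mono) auto
  moreover have "?m * base_weight y \<le> \<eta> * base_weight y" "?m * base_weight y \<le> 1/4 * base_weight y" using base_weight_pos[of y]
    by (intro mult_right_mono; simp)+
  ultimately show "tilt \<eta> N \<le> \<eta> * base_weight y" "tilt \<eta> N \<le> base_weight y / 4" by auto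
qed

lemma tilt_level:
  assumes "N \<ge> 1"
  shows "tilt \<eta> N * level \<alpha> \<Delta> N = tilt \<eta> 1 / K \<alpha> \<Delta> * real N powr (1 + min \<alpha> 0 - \<alpha>)"
proof -
  have "real N powr min \<alpha> 0 * real N powr (1 - \<alpha>) = real N powr (1 + min \<alpha> 0 - \<alpha>)"
    by (simp flip: powr_add add: algebra_simps)
  thus ?thesis by (simp add: tilt_def level_def)
qed

lemma exponent_gap: "1 + min \<alpha> 0 - \<alpha> > 0"
  using exponent by auto

lemma eventually_level:
  assumes "\<epsilon> > 0" "\<epsilon> < 1"
  shows "\<forall>\<^sub>F N in sequentially. (1 - \<epsilon>) * (level \<alpha> \<Delta> (N - 1) - level \<alpha> \<Delta> Y) \<ge> (1 - 2 * \<epsilon>) * level \<alpha> \<Delta> N"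
proof -
  define C where "C = real Y powr (1 - \<alpha>)"
  have "((\<lambda>N::nat. ((real N - 1) powr (1 - \<alpha>) - C) / real N powr (1 - \<alpha>)) \<longlongrightarrow> 1) sequentially"
    using exponent by real_asymp
  hence "\<forall>\<^sub>F N::nat in sequentially. ((real N - 1) powr (1 - \<alpha>) - C) / real N powr (1 - \<alpha>) > (1 - 2 * \<epsilon>) / (1 - \<epsilon>)"
    using assms by (intro order_tendstoD(1)) auto
  thus ?thesis using eventually_ge_at_top[of 1]
  proof eventually_elim
    case (elim N)
    have K: "K \<alpha> \<Delta> > 0" using K_pos exponent reinforcement_pos by blast
    have "(1 - 2 * \<epsilon>) * real N powr (1 - \<alpha>) \<le> (1 - \<epsilon>) * ((real N - 1) powr (1 - \<alpha>) - C)"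
      using elim assms by (simp add: divide_simps mult_ac split: if_splits)
    hence "(1 - 2 * \<epsilon>) * real N powr (1 - \<alpha>) / K \<alpha> \<Delta> \<le> (1 - \<epsilon>) * ((real N - 1) powr (1 - \<alpha>) - C) / K \<alpha> \<Delta>"
      using K by (intro divide_right_mono) auto
    moreover have "(1 - \<epsilon>) * (level \<alpha> \<Delta> (N - 1) - level \<alpha> \<Delta> Y) =
                   (1 - \<epsilon>) * ((real N - 1) powr (1 - \<alpha>) - C) / K \<alpha> \<Delta>"
      using elim(2) by (simp add: level_def C_def of_nat_diff diff_divide_distrib [symmetric])
    ultimately show ?case by (simp add: level_def)
  qed
qed

text \<open>In \<open>prob_hit_early\<close> the time contributes \<open>(1 - \<delta>) * level \<alpha> \<Delta> N\<close> to the exponent and the potential at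
  least \<open>-(1 - \<delta>/2) * level \<alpha> \<Delta> N\<close>, both multiplied by the tilt.\<close>

theorem summable_hit_early:
  assumes \<delta>: "0 < \<delta>" "\<delta> < 1"
  shows "summable (\<lambda>N. prob {\<omega>\<in>space M. \<exists>k\<le>nat \<lfloor>exp ((1 - \<delta>) * level \<alpha> \<Delta> N)\<rfloor>. X k \<omega> = N})"
proof -
  have \<epsilon>: "0 < \<delta> / 4" "\<delta> / 4 < 1" using \<delta> by auto
  obtain \<eta> Y where gap: "\<eta> > 0" "Y \<ge> 1"
    "\<And>y s. y \<ge> Y \<Longrightarrow> 0 < s \<Longrightarrow> s \<le> \<eta> \<Longrightarrow> s \<le> \<eta> * scaled_weight \<alpha> \<Delta> y \<Longrightarrow>
    (1 - \<delta> / 4) * (level \<alpha> \<Delta> (Suc y) - level \<alpha> \<Delta> y)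
        \<le> Digamma (scaled_weight \<alpha> \<Delta> y + 1/2 - s) - Digamma (scaled_weight \<alpha> \<Delta> y + s)"
    by (rule level_step_bounds[OF exponent reinforcement_pos \<epsilon>]) blast
  define c where "c = \<delta> / 2 * (tilt \<eta> 1 / K \<alpha> \<Delta>)"
  have c: "c > 0" using \<delta> K_pos[OF exponent reinforcement_pos] tilt_bounds(1)[OF gap(1), of 1]
    by (simp add: c_def)
  define \<gamma> where "\<gamma> = 1 + min \<alpha> 0 - \<alpha>"
  have \<gamma>: "\<gamma> > 0" using exponent_gap by (simp add: \<gamma>_def)
  define A where "A = 1 / (2 * \<Delta>)"
  have A: "A > 0" using reinforcement_pos by (simp add: A_def)
  define h where "h = (\<lambda>N::nat. 12 * (1 + A * N) * (1 + A) * exp (- c * N powr \<gamma>))"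
  have bound: "\<forall>\<^sub>F N in sequentially.
    prob {\<omega>\<in>space M. \<exists>k\<le>nat \<lfloor>exp ((1 - \<delta>) * level \<alpha> \<Delta> N)\<rfloor>. X k \<omega> = N} \<le> h N"
    using eventually_level[OF \<epsilon>, of Y] eventually_ge_at_top[of "Y + 2"]
  proof eventually_elim
    case (elim N)
    define s where "s = tilt \<eta> N"
    define t where "t = nat \<lfloor>exp ((1 - \<delta>) * level \<alpha> \<Delta> N)\<rfloor>"
    define E where "E = exp ((1 - \<delta>) * level \<alpha> \<Delta> N)"
    let ?G = "\<lambda>y. Digamma (base_weight y + 1/2 - s) - Digamma (base_weight y + s)"
    have N: "N \<ge> 1" "N \<ge> 2" "Y \<le> N - 1" using elim by auto
    note s = tilt_bounds[OF gap(1) N(1), folded s_def]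
    have sb: "s < base_weight y" if "y < N" for y using s(5)[OF that] base_weight_pos[of y] by simp
    have G: "?G y \<ge> 0" if "y < N" for y
      using Digamma_real_mono[of "base_weight y + s" "base_weight y + 1/2 - s"] s(1,2) base_weight_pos[of y] by simp
    have "(1 - 2 * (\<delta> / 4)) * level \<alpha> \<Delta> N \<le> (1 - \<delta> / 4) * (level \<alpha> \<Delta> (N - 1) - level \<alpha> \<Delta> Y)"
      by (rule elim(1))
    also have "\<dots> = (\<Sum>y\<in>{Y..<N - 1}. (1 - \<delta> / 4) * (level \<alpha> \<Delta> (Suc y) - level \<alpha> \<Delta> y))"
      using N by (intro sum_level [symmetric])
    also have "\<dots> \<le> (\<Sum>y\<in>{Y..<N - 1}. ?G y)"
    proof (rule sum_mono)
      fix y assume "y \<in> {Y..<N - 1}"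
      hence y: "y \<ge> Y" "y < N" by auto
      show "(1 - \<delta> / 4) * (level \<alpha> \<Delta> (Suc y) - level \<alpha> \<Delta> y) \<le> ?G y"
        unfolding base_weight_eq using y s(1,3) s(4)[OF y(2)] by (intro gap(3)) (auto simp: base_weight_eq)
    qed
    also have "\<dots> \<le> (\<Sum>y\<in>{1..<N - 1}. ?G y)" using G gap(2) by (intro sum_mono2) auto
    finally have S: "(1 - \<delta> / 2) * level \<alpha> \<Delta> N \<le> (\<Sum>y\<in>{1..<N - 1}. ?G y)" by simp
    have b0: "base_weight 0 = A" by (simp add: base_weight_def power_weights_def A_def)
    have E1: "E \<ge> 1" using level_nonneg[OF exponent reinforcement_pos, of N] \<delta> by (simp add: E_def)
    have tE: "real t \<le> E" unfolding t_def E_def by (simp add: of_nat_nat)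
    have "base_weight 0 + t / 2 \<le> A * E + E" using tE E1 A mult_left_mono[of 1 E A] unfolding b0 by linarith
    hence "(base_weight 0 + t / 2) powr s \<le> ((1 + A) * E) powr s"
      using s(1) A by (intro powr_mono2) (auto simp: b0 algebra_simps)
    also have "\<dots> = (1 + A) powr s * E powr s" using A E1 by (simp add: powr_mult)
    also have "\<dots> \<le> (1 + A) powr 1 * E powr s" using A s(2) by (intro mult_right_mono powr_mono) auto
    also have "\<dots> = (1 + A) * exp (s * ((1 - \<delta>) * level \<alpha> \<Delta> N))"
      using A by (simp add: E_def powr_def)
    finally have P: "(base_weight 0 + t / 2) powr s \<le> (1 + A) * exp (s * ((1 - \<delta>) * level \<alpha> \<Delta> N))" .
    have "prob {\<omega>\<in>space M. \<exists>k\<le>t. X k \<omega> = N} \<le> 12 * (1 + base_weight (N - 1)) * (base_weight 0 + t / 2) powr s *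
     exp (- s * (\<Sum>y\<in>{1..<N - 1}. ?G y))"
      by (intro prob_hit_early N s sb)
    also have "\<dots> \<le> 12 * (1 + A * N) * ((1 + A) * exp (s * ((1 - \<delta>) * level \<alpha> \<Delta> N))) *
     exp (- s * ((1 - \<delta> / 2) * level \<alpha> \<Delta> N))"
    proof (intro mult_mono P)
      show "1 + base_weight (N - 1) \<le> 1 + A * N"
        using scaled_weight_le[OF reinforcement_pos, of "N - 1" N \<alpha>] exponent N by (simp add: base_weight_eq A_def)
      show "exp (- s * (\<Sum>y\<in>{1..<N - 1}. ?G y)) \<le> exp (- s * ((1 - \<delta> / 2) * level \<alpha> \<Delta> N))"
        using S s(1) by (simp add: mult_left_mono)
    qed (use A base_weight_pos[of "N - 1"] in auto)
    also have "\<dots> = 12 * (1 + A * N) * (1 + A) * exp (- (\<delta> / 2) * (s * level \<alpha> \<Delta> N))"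
      by (simp add: exp_add [symmetric] algebra_simps)
    also have "- (\<delta> / 2) * (s * level \<alpha> \<Delta> N) = - c * N powr \<gamma>"
      unfolding s_def tilt_level[OF N(1)] by (simp add: c_def \<gamma>_def)
    finally show ?case by (simp add: h_def t_def)
  qed
  have "((\<lambda>N::nat. h N * real N ^ 2) \<longlongrightarrow> 0) sequentially"
    unfolding h_def using A c \<gamma> by real_asymp
  hence "\<forall>\<^sub>F N in sequentially. h N * real N ^ 2 < 1" by (rule order_tendstoD) simp
  hence "\<forall>\<^sub>F N in sequentially. norm (prob {\<omega>\<in>space M. \<exists>k\<le>nat \<lfloor>exp ((1 - \<delta>) * level \<alpha> \<Delta> N)\<rfloor>. X k \<omega> = N}) \<le> 1 / real N ^ 2"
    using bound eventually_ge_at_top[of 1]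
  proof eventually_elim
    case (elim N)
    hence "h N \<le> 1 / real N ^ 2" by (simp add: field_simps)
    with elim show ?case by simp
  qed
  thus ?thesis
    by (rule summable_comparison_test_ev) (use inverse_power_summable[of 2, where ?'a = real] in \<open>simp add: inverse_eq_divide\<close>)
qed

text \<open>In \<open>prob_hit_late\<close> the time contributes \<open>-(1 + \<delta>) * level \<alpha> \<Delta> N\<close> and the potential at most
  \<open>(1 + \<delta>/2) * level \<alpha> \<Delta> N\<close>, both multiplied by the tilt; this outweighs the polynomial factors.\<close>

theorem tendsto_hit_late:
  assumes \<delta>: "0 < \<delta>" "\<delta> < 1"
  shows "(\<lambda>N. prob {\<omega>\<in>space M. \<forall>k\<le>nat \<lfloor>exp ((1 + \<delta>) * level \<alpha> \<Delta> N)\<rfloor>. X k \<omega> \<noteq> N}) \<longlonglongrightarrow> 0"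
proof -
  have \<epsilon>: "0 < \<delta> / 2" "\<delta> / 2 < 1" using \<delta> by auto
  obtain \<eta> Y where gap: "\<eta> > 0" "Y \<ge> 1"
    "\<And>y s. y \<ge> Y \<Longrightarrow> 0 < s \<Longrightarrow> s \<le> \<eta> \<Longrightarrow> s \<le> \<eta> * scaled_weight \<alpha> \<Delta> y \<Longrightarrow>
    Digamma (scaled_weight \<alpha> \<Delta> y + 1/2 + s) - Digamma (scaled_weight \<alpha> \<Delta> y - s)
        \<le> (1 + \<delta> / 2) * (level \<alpha> \<Delta> (Suc y) - level \<alpha> \<Delta> y)"
    by (rule level_step_bounds[OF exponent reinforcement_pos \<epsilon>]) blast
  define c where "c = \<delta> / 2 * (tilt \<eta> 1 / K \<alpha> \<Delta>)"
  have c: "c > 0" using \<delta> K_pos[OF exponent reinforcement_pos] tilt_bounds(1)[OF gap(1), of 1]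
    by (simp add: c_def)
  define \<gamma> where "\<gamma> = 1 + min \<alpha> 0 - \<alpha>"
  have \<gamma>: "\<gamma> > 0" using exponent_gap by (simp add: \<gamma>_def)
  define A where "A = 1 / (2 * \<Delta>)"
  have A: "A > 0" using reinforcement_pos by (simp add: A_def)
  \<comment> \<open>The finitely many edges below \<open>Y\<close> are bounded uniformly in the tilt, which is at most a quarter
    both of \<open>1\<close> and of the weight.\<close>
  define C where "C = (\<Sum>y\<in>{1..<Y}. Digamma (base_weight y + 1) - Digamma (3/4 * base_weight y))"
  have C: "C \<ge> 0" unfolding C_def using base_weight_pos by (intro sum_nonneg) (simp add: Digamma_real_mono add_increasing2)
  define h where "h = (\<lambda>N::nat. 24 * (real N)\<^sup>2 * (A * N + 2)\<^sup>2 * (4 * N) * exp C * exp (- c * N powr \<gamma>))"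
  have bound: "\<forall>\<^sub>F N in sequentially.
    prob {\<omega>\<in>space M. \<forall>k\<le>nat \<lfloor>exp ((1 + \<delta>) * level \<alpha> \<Delta> N)\<rfloor>. X k \<omega> \<noteq> N} \<le> h N"
    using eventually_ge_at_top[of "Y + 2"]
  proof eventually_elim
    case (elim N)
    define s where "s = tilt \<eta> N"
    define t where "t = nat \<lfloor>exp ((1 + \<delta>) * level \<alpha> \<Delta> N)\<rfloor>"
    define E where "E = exp ((1 + \<delta>) * level \<alpha> \<Delta> N)"
    let ?G = "\<lambda>y. Digamma (base_weight y + 1/2 + s) - Digamma (base_weight y - s)"
    have N: "N \<ge> 1" "N \<ge> 2" "Y \<le> N" using elim by auto
    note s = tilt_bounds[OF gap(1) N(1), folded s_def]
    have sb: "s \<le> base_weight y / 2" if "y < N" for y using s(5)[OF that] base_weight_pos[of y] by simp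
    have bA: "base_weight y \<le> A * N" if "y < N" for y
      using scaled_weight_le[OF reinforcement_pos that exponent] by (simp add: base_weight_eq A_def)
    have E1: "E \<ge> 1" using level_nonneg[OF exponent reinforcement_pos, of N] \<delta> by (simp add: E_def)
    have t1: "t \<ge> 1" using E1 unfolding t_def E_def[symmetric] by (simp add: le_nat_iff le_floor_iff)
    \<comment> \<open>Rounding down costs at most a factor \<open>2\<close>.\<close>
    have tE: "real t \<ge> E / 2"
    proof -
      have "real t > E - 1" unfolding t_def E_def[symmetric] using E1 by (simp add: of_nat_nat)
      thus ?thesis using t1 by linarith
    qed
    have "(\<Sum>y\<in>{1..<N}. ?G y) = (\<Sum>y\<in>{1..<Y}. ?G y) + (\<Sum>y\<in>{Y..<N}. ?G y)"
      using N gap(2) by (intro sum.atLeastLessThan_concat [symmetric])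
    also have "(\<Sum>y\<in>{1..<Y}. ?G y) \<le> C" unfolding C_def
    proof (rule sum_mono)
      fix y assume "y \<in> {1..<Y}"
      hence y: "y < N" using N by auto
      have "Digamma (base_weight y + 1/2 + s) \<le> Digamma (base_weight y + 1)" using s(1,2) base_weight_pos[of y]
        by (intro Digamma_real_mono) auto
      moreover have "Digamma (3/4 * base_weight y) \<le> Digamma (base_weight y - s)" using s(5)[OF y] base_weight_pos[of y]
        by (intro Digamma_real_mono) auto
      ultimately show "?G y \<le> Digamma (base_weight y + 1) - Digamma (3/4 * base_weight y)" by simp
    qed
    also have "(\<Sum>y\<in>{Y..<N}. ?G y) \<le> (\<Sum>y\<in>{Y..<N}. (1 + \<delta> / 2) * (level \<alpha> \<Delta> (Suc y) - level \<alpha> \<Delta> y))"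
    proof (rule sum_mono)
      fix y assume "y \<in> {Y..<N}"
      hence y: "y \<ge> Y" "y < N" by auto
      show "?G y \<le> (1 + \<delta> / 2) * (level \<alpha> \<Delta> (Suc y) - level \<alpha> \<Delta> y)"
        unfolding base_weight_eq using y s(1,3) s(4)[OF y(2)] by (intro gap(3)) (auto simp: base_weight_eq)
    qed
    also have "\<dots> = (1 + \<delta> / 2) * (level \<alpha> \<Delta> N - level \<alpha> \<Delta> Y)" using N by (intro sum_level)
    also have "\<dots> \<le> (1 + \<delta> / 2) * level \<alpha> \<Delta> N"
      using \<delta> level_nonneg[OF exponent reinforcement_pos, of Y] by (intro mult_left_mono) auto
    finally have S: "(\<Sum>y\<in>{1..<N}. ?G y) \<le> C + (1 + \<delta> / 2) * level \<alpha> \<Delta> N" by simp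
    have "s * (\<Sum>y\<in>{1..<N}. ?G y) \<le> s * (C + (1 + \<delta> / 2) * level \<alpha> \<Delta> N)"
      using S s(1) by (intro mult_left_mono) auto
    also have "\<dots> \<le> C + s * ((1 + \<delta> / 2) * level \<alpha> \<Delta> N)"
      using C s(1,2) mult_right_mono[of s 1 C] by (simp add: algebra_simps)
    finally have S': "s * (\<Sum>y\<in>{1..<N}. ?G y) \<le> C + s * ((1 + \<delta> / 2) * level \<alpha> \<Delta> N)" .
    have "2 * N / t \<le> 2 * N / (E / 2)" using tE E1 by (intro divide_left_mono) auto
    also have "\<dots> = 4 * N * (1 / E)" by simp
    finally have "(2 * N / t) powr s \<le> (4 * N * (1 / E)) powr s"
      using s(1) by (intro powr_mono2) auto
    also have "\<dots> = (4 * N) powr s * (1 / E) powr s" using E1 by (subst powr_mult) auto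
    also have "\<dots> \<le> (4 * N) powr 1 * (1 / E) powr s" using s(2) N(1) by (intro mult_right_mono powr_mono) auto
    also have "\<dots> = 4 * N * exp (- s * ((1 + \<delta>) * level \<alpha> \<Delta> N))"
      using N by (simp add: E_def powr_def ln_div)
    finally have P: "(2 * N / t) powr s \<le> 4 * N * exp (- s * ((1 + \<delta>) * level \<alpha> \<Delta> N))" .
    have "prob {\<omega>\<in>space M. \<forall>k\<le>t. X k \<omega> \<noteq> N} \<le> 24 * N\<^sup>2 * (A * N + 2)\<^sup>2 * (2 * N / t) powr s *
     exp (s * (\<Sum>y\<in>{1..<N}. ?G y))"
      by (intro prob_hit_late N t1 s sb bA)
    also have "\<dots> \<le> 24 * N\<^sup>2 * (A * N + 2)\<^sup>2 * (4 * N * exp (- s * ((1 + \<delta>) * level \<alpha> \<Delta> N))) *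
     exp (C + s * ((1 + \<delta> / 2) * level \<alpha> \<Delta> N))"
      using S' by (intro mult_mono P) auto
    also have "\<dots> = 24 * N\<^sup>2 * (A * N + 2)\<^sup>2 * (4 * N) * exp C * exp (- (\<delta> / 2) * (s * level \<alpha> \<Delta> N))"
      by (simp add: exp_add [symmetric] algebra_simps)
    also have "- (\<delta> / 2) * (s * level \<alpha> \<Delta> N) = - c * N powr \<gamma>"
      unfolding s_def tilt_level[OF N(1)] by (simp add: c_def \<gamma>_def)
    finally show ?case by (simp add: h_def t_def)
  qed
  have "(h \<longlongrightarrow> 0) sequentially"
    unfolding h_def using A c \<gamma> by real_asymp
  thus ?thesis using bound by (intro tendsto_sandwich[OF _ bound tendsto_const]) auto
qed

end

section \<open>From hitting times to the upper limit\<close>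

definition scaled :: "real \<Rightarrow> real \<Rightarrow> (nat \<Rightarrow> nat) \<Rightarrow> nat \<Rightarrow> real" where
  "scaled \<alpha> \<Delta> x n = real (x n) / (K \<alpha> \<Delta> * ln (real n)) powr (1 / (1 - \<alpha>))"

text \<open>At time \<open>n\<close> the walk stands at \<open>N = x n\<close>. For large \<open>N\<close> this forces \<open>n\<close> to exceed the stated time,
  and solving for \<open>N\<close> gives the bound. The remaining levels \<open>N < N0\<close> are bounded while the
  normalization tends to infinity.\<close>

lemma scaled_upper:
  assumes "\<alpha> < 1" "\<Delta> > 0" "0 < \<delta>" "\<delta> < 1"
    and late: "\<forall>\<^sub>F N in sequentially. \<forall>k\<le>nat \<lfloor>exp ((1 - \<delta>) * level \<alpha> \<Delta> N)\<rfloor>. x k \<noteq> N"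
  shows "\<forall>\<^sub>F n in sequentially. scaled \<alpha> \<Delta> x n \<le> (1 - \<delta>) powr (- 1 / (1 - \<alpha>))"
proof -
  obtain N0 where N0: "\<And>N k. N \<ge> N0 \<Longrightarrow> k \<le> nat \<lfloor>exp ((1 - \<delta>) * level \<alpha> \<Delta> N)\<rfloor> \<Longrightarrow> x k \<noteq> N"
    using late unfolding eventually_sequentially by blast
  have K: "K \<alpha> \<Delta> > 0" using assms by (intro K_pos)
  define e where "e = 1 / (1 - \<alpha>)"
  have e: "e > 0" using assms by (simp add: e_def)
  have "((\<lambda>n::nat. real N0 / (K \<alpha> \<Delta> * ln (real n)) powr e) \<longlongrightarrow> 0) sequentially"
    using K e by real_asymp
  hence "\<forall>\<^sub>F n::nat in sequentially. real N0 / (K \<alpha> \<Delta> * ln (real n)) powr e < (1 - \<delta>) powr (- e)"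
    using assms by (intro order_tendstoD(2)) auto
  hence "\<forall>\<^sub>F n::nat in sequentially. scaled \<alpha> \<Delta> x n \<le> (1 - \<delta>) powr (- e)"
    using eventually_ge_at_top[of 2]
  proof eventually_elim
    case (elim n)
    define R where "R = K \<alpha> \<Delta> * ln (real n)"
    have R: "R > 0" using K elim by (simp add: R_def)
    show ?case
    proof (cases "x n < N0")
      case True
      hence "real (x n) / R powr e \<le> real N0 / R powr e" by (intro divide_right_mono) auto
      thus ?thesis using elim by (simp add: scaled_def R_def e_def)
    next
      case False
      hence "\<not> n \<le> nat \<lfloor>exp ((1 - \<delta>) * level \<alpha> \<Delta> (x n))\<rfloor>" using N0[of "x n" n] by auto
      hence "exp ((1 - \<delta>) * level \<alpha> \<Delta> (x n)) \<le> real n" by linarith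
      hence "(1 - \<delta>) * level \<alpha> \<Delta> (x n) \<le> ln (real n)" using elim by (subst ln_ge_iff) auto
      hence "(1 - \<delta>) * real (x n) powr (1 - \<alpha>) \<le> R"
        using K by (simp add: level_def R_def field_simps)
      hence "real (x n) powr (1 - \<alpha>) \<le> R / (1 - \<delta>)" using assms by (simp add: field_simps)
      hence "(real (x n) powr (1 - \<alpha>)) powr e \<le> (R / (1 - \<delta>)) powr e"
        using e by (intro powr_mono2) auto
      also have "(real (x n) powr (1 - \<alpha>)) powr e = real (x n)"
        using assms by (simp add: powr_powr e_def)
      also have "(R / (1 - \<delta>)) powr e = R powr e * (1 - \<delta>) powr (- e)"
        using R assms by (simp add: powr_divide powr_minus field_simps)
      finally have "real (x n) / R powr e \<le> (1 - \<delta>) powr (- e)"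
        using R by (simp add: field_simps)
      thus ?thesis by (simp add: scaled_def R_def e_def)
    qed
  qed
  thus ?thesis by (simp add: e_def)
qed

text \<open>A level \<open>N\<close> reached at a time \<open>k\<close> that is not late gives the bound at \<open>n = k\<close>. Since \<open>k \<ge> N\<close>,
  such times are arbitrarily large.\<close>

lemma scaled_lower:
  assumes "\<alpha> < 1" "\<Delta> > 0" "0 < \<delta>" and le: "\<And>n. x n \<le> n"
    and early: "\<exists>\<^sub>F N in sequentially. \<exists>k\<le>nat \<lfloor>exp ((1 + \<delta>) * level \<alpha> \<Delta> N)\<rfloor>. x k = N"
  shows "\<exists>\<^sub>F n in sequentially. scaled \<alpha> \<Delta> x n \<ge> (1 + \<delta>) powr (- 1 / (1 - \<alpha>))"
  unfolding frequently_sequentially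
proof
  fix n0 :: nat
  have K: "K \<alpha> \<Delta> > 0" using assms by (intro K_pos)
  define e where "e = 1 / (1 - \<alpha>)"
  have e: "e > 0" using assms by (simp add: e_def)
  obtain N k where N: "N \<ge> max 2 n0" "k \<le> nat \<lfloor>exp ((1 + \<delta>) * level \<alpha> \<Delta> N)\<rfloor>" "x k = N"
    using early unfolding frequently_sequentially by blast
  have k: "k \<ge> n0" "k \<ge> 2" using le[of k] N by auto
  define R where "R = K \<alpha> \<Delta> * ln (real k)"
  have R: "R > 0" using K k by (simp add: R_def)
  have "real k \<le> exp ((1 + \<delta>) * level \<alpha> \<Delta> N)" using N(2) k(2) by linarith
  hence "ln (real k) \<le> ln (exp ((1 + \<delta>) * level \<alpha> \<Delta> N))" using k by (subst ln_le_cancel_iff) auto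
  hence "ln (real k) \<le> (1 + \<delta>) * level \<alpha> \<Delta> N" by simp
  hence "R \<le> (1 + \<delta>) * real N powr (1 - \<alpha>)"
    using K by (simp add: level_def R_def field_simps)
  hence "R powr e \<le> ((1 + \<delta>) * real N powr (1 - \<alpha>)) powr e" using R e by (intro powr_mono2) auto
  also have "\<dots> = (1 + \<delta>) powr e * real N"
    using assms by (simp add: powr_mult powr_powr e_def)
  finally have "(1 + \<delta>) powr (- e) \<le> real N / R powr e"
    using R assms by (simp add: powr_minus field_simps)
  hence "scaled \<alpha> \<Delta> x k \<ge> (1 + \<delta>) powr (- 1 / (1 - \<alpha>))"
    using N(3) by (simp add: scaled_def R_def e_def)
  thus "\<exists>n\<ge>n0. scaled \<alpha> \<Delta> x n \<ge> (1 + \<delta>) powr (- 1 / (1 - \<alpha>))" using k by blast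
qed

text \<open>The event that \<open>A n\<close> occurs for all \<open>n \<ge> m\<close> is contained in events of arbitrarily small
  probability.\<close>

lemma (in prob_space) AE_frequently_not:
  assumes [measurable]: "\<And>n. A n \<in> events" and lim: "(\<lambda>n. prob (A n)) \<longlonglongrightarrow> 0"
  shows "AE \<omega> in M. \<exists>\<^sub>F n in sequentially. \<omega> \<notin> A n"
proof -
  have "AE \<omega> in M. \<exists>n\<ge>m. \<omega> \<notin> A n" for m
  proof -
    have S: "(\<Inter>n\<in>{m..}. A n) \<in> events" by measurable
    have "prob (\<Inter>n\<in>{m..}. A n) \<le> 0"
    proof (rule LIMSEQ_le_const[OF lim])
      have "prob (\<Inter>n\<in>{m..}. A n) \<le> prob (A k)" if "k \<ge> m" for k
        using that by (intro finite_measure_mono) auto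
      thus "\<exists>N. \<forall>n\<ge>N. prob (\<Inter>n\<in>{m..}. A n) \<le> prob (A n)" by blast
    qed
    hence "prob (\<Inter>n\<in>{m..}. A n) = 0" by (simp add: measure_le_0_iff)
    hence "AE \<omega> in M. \<omega> \<notin> (\<Inter>n\<in>{m..}. A n)"
      using S prob_eq_0 by blast
    thus ?thesis by eventually_elim auto
  qed
  hence "AE \<omega> in M. \<forall>m. \<exists>n\<ge>m. \<omega> \<notin> A n" by (subst AE_all_countable) blast
  thus ?thesis by eventually_elim (simp add: frequently_sequentially)
qed

theorem theorem2p2:
  fixes \<alpha> \<Delta> :: real and M :: "'a measure" and X :: "nat \<Rightarrow> 'a \<Rightarrow> nat"
  assumes "\<alpha> < 1" and "\<Delta> > 0"
    and "lerrw M (power_weights \<alpha>) \<Delta> X"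
  shows "AE \<omega> in M.
    limsup (\<lambda>n. ereal (real (X n \<omega>) / (K \<alpha> \<Delta> * ln (real n)) powr (1 / (1 - \<alpha>)))) = 1"
proof -
  interpret lerrw M "power_weights \<alpha>" \<Delta> X by fact
  interpret power_lerrw M \<alpha> \<Delta> X by unfold_locales fact+
  define d where "d = (\<lambda>m::nat. 1 / (real m + 2))"
  have d: "0 < d m" "d m < 1" for m by (auto simp: d_def)
  have upper: "AE \<omega> in M. \<forall>m. \<forall>\<^sub>F N in sequentially.
      \<forall>k\<le>nat \<lfloor>exp ((1 - d m) * level \<alpha> \<Delta> N)\<rfloor>. X k \<omega> \<noteq> N"
  proof (subst AE_all_countable, intro allI)
    fix m
    have "AE \<omega> in M. \<forall>\<^sub>F N in sequentially.
        \<omega> \<in> space M - {\<omega>\<in>space M. \<exists>k\<le>nat \<lfloor>exp ((1 - d m) * level \<alpha> \<Delta> N)\<rfloor>. X k \<omega> = N}"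
      by (intro borel_cantelli_AE1 summable_hit_early d) (auto simp: emeasure_eq_measure)
    thus "AE \<omega> in M. \<forall>\<^sub>F N in sequentially. \<forall>k\<le>nat \<lfloor>exp ((1 - d m) * level \<alpha> \<Delta> N)\<rfloor>. X k \<omega> \<noteq> N"
      by eventually_elim (auto elim!: eventually_mono)
  qed
  have lower: "AE \<omega> in M. \<forall>m. \<exists>\<^sub>F N in sequentially.
      \<exists>k\<le>nat \<lfloor>exp ((1 + d m) * level \<alpha> \<Delta> N)\<rfloor>. X k \<omega> = N"
  proof (subst AE_all_countable, intro allI)
    fix m
    have "AE \<omega> in M. \<exists>\<^sub>F N in sequentially.
        \<omega> \<notin> {\<omega>\<in>space M. \<forall>k\<le>nat \<lfloor>exp ((1 + d m) * level \<alpha> \<Delta> N)\<rfloor>. X k \<omega> \<noteq> N}"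
      by (intro AE_frequently_not tendsto_hit_late d) auto
    thus "AE \<omega> in M. \<exists>\<^sub>F N in sequentially. \<exists>k\<le>nat \<lfloor>exp ((1 + d m) * level \<alpha> \<Delta> N)\<rfloor>. X k \<omega> = N"
      using AE_space by eventually_elim (auto elim!: frequently_elim1)
  qed
  have lim_up: "(\<lambda>m. ereal ((1 - d m) powr (- 1 / (1 - \<alpha>)))) \<longlonglongrightarrow> ereal 1"
    unfolding d_def using assms by (intro tendsto_ereal) real_asymp
  have lim_low: "(\<lambda>m. ereal ((1 + d m) powr (- 1 / (1 - \<alpha>)))) \<longlonglongrightarrow> ereal 1"
    unfolding d_def using assms by (intro tendsto_ereal) real_asymp
  from upper lower AE_X_le show ?thesis
  proof eventually_elim
    case (elim \<omega>)
    define x where "x = (\<lambda>n. X n \<omega>)"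
    let ?L = "limsup (\<lambda>n. ereal (scaled \<alpha> \<Delta> x n))"
    have up: "?L \<le> ereal ((1 - d m) powr (- 1 / (1 - \<alpha>)))" for m
    proof (rule Limsup_bounded)
      have "\<forall>\<^sub>F n in sequentially. scaled \<alpha> \<Delta> x n \<le> (1 - d m) powr (- 1 / (1 - \<alpha>))"
        by (rule scaled_upper) (use assms d elim in \<open>auto simp: x_def\<close>)
      thus "\<forall>\<^sub>F n in sequentially. ereal (scaled \<alpha> \<Delta> x n) \<le> ereal ((1 - d m) powr (- 1 / (1 - \<alpha>)))"
        by simp
    qed
    have low: "ereal ((1 + d m) powr (- 1 / (1 - \<alpha>))) \<le> ?L" for m
    proof (rule ccontr)
      assume "\<not> ?thesis"
      hence "\<forall>\<^sub>F n in sequentially. ereal (scaled \<alpha> \<Delta> x n) < ereal ((1 + d m) powr (- 1 / (1 - \<alpha>)))"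
        by (intro Limsup_lessD) auto
      hence "\<not> (\<exists>\<^sub>F n in sequentially. scaled \<alpha> \<Delta> x n \<ge> (1 + d m) powr (- 1 / (1 - \<alpha>)))"
        unfolding not_frequently by (simp add: not_le)
      moreover have "\<exists>\<^sub>F n in sequentially. scaled \<alpha> \<Delta> x n \<ge> (1 + d m) powr (- 1 / (1 - \<alpha>))"
        by (rule scaled_lower) (use assms d elim in \<open>auto simp: x_def\<close>)
      ultimately show False by blast
    qed
    have "?L \<le> ereal 1" by (rule LIMSEQ_le_const[OF lim_up]) (use up in blast)
    moreover have "ereal 1 \<le> ?L" by (rule LIMSEQ_le_const2[OF lim_low]) (use low in blast)
    ultimately have "?L = 1" by (simp add: one_ereal_def)
    thus ?case by (simp add: scaled_def x_def)
  qed
qed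

end
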